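(* Let $X$ be a separable Fréchet space and let $T:X\to X$ be a continuous linear operator. The following are equivalent: (i) $T$ is weakly mixing and multiply recurrent. (ii) $T\oplus T$ is $\mathcal{AP}$-hypercyclic. (iii) For every $n\in\mathbb{N}$, $n\geq 1$, the $n$-fold direct sum $T\oplus T\oplus\dots\oplus T$ is $\mathcal{AP}$-hypercyclic. (iv) ($T$ is hereditarily $\mathcal{AP}$-hypercyclic) There is $(n_k)_k\in\mathcal{AP}$ such that for every subsequence $(m_k)_k$ of $(n_k)_k$ with $(m_k)_k\in\mathcal{AP}$ there is some $x\in X$ satisfying $N_T(x,U)\cap (m_k)_k\in\mathcal{AP}$ for every nonempty open set $U\subseteq X$. (v) There are a family $(n_{k,j})_{k\in\mathbb{N},\,0\le j\le k}$ of natural numbers of the form $n_{k,j}=a_k+jc_k$ with $a_k\in\mathbb{N}$ and $c_k\ge 1$, dense sets $X_0,Y_0\subseteq X$, and maps $S_{k,j}:Y_0\to X$ ($k\in\mathbb{N}$, $0\le j\le k$) such that for every $x\in X_0$ and every $y\in Y_0$, as $k\to\infty$, (a) $T^{n_{k,j}}(x)\to 0$, (b) $(S_{k,0}+\dots+S_{k,k})(y)\to 0$, (c) $T^{n_{k,j}}\big((S_{k,0}+\dots+S_{k,k})(y)\big)\to y$, where the convergence in (a) and (c) is independent of the choice of $j\le k$, i.e. it holds along $j=j_k$ for every choice of indices $0\le j_k\le k$. (vi) For all nonempty open sets $U,V_1,V_2\subseteq X$ and every length $m\in\mathbb{N}$ there are $x_1,x_2\in U$ and $a,k\in\mathbb{N}$,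 $k\ge 1$, such that $T^{a+jk}(x_i)\in V_i$ for every $0\le j\le m$ and $i=1,2$.
   Context: $\mathcal{AP}$ is the family of all subsets of $\mathbb{N}$ that contain arbitrarily long (finite) arithmetic progressions $\{a,a+k,\dots,a+mk\}$ (common difference $k\ge 1$); a strictly increasing sequence $(n_k)_k$ of natural numbers is identified with the set of its terms, so $(n_k)_k\in\mathcal{AP}$ means that this set belongs to $\mathcal{AP}$. For an operator $R$ on a space $Z$, $N_R(z,U)=\{n\in\mathbb{N}: R^n z\in U\}$. $R$ is $\mathcal{AP}$-hypercyclic if there is $z\in Z$ such that $N_R(z,U)\in\mathcal{AP}$ for every nonempty open $U\subseteq Z$. $R$ is hypercyclic if some vector has a dense orbit. $T$ is weakly mixing if $T\oplus T$ is hypercyclic on $X\oplus X$. $T$ is multiply recurrent if for every nonempty open set $U$ and every $m\in\mathbb{N}$ there is $k\ge 1$ such that $U\cap T^{-k}(U)\cap\dots\cap T^{-km}(U)\neq\emptyset$. *)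

theory Defs
  imports "HOL-Analysis.Analysis"
begin

text \<open>
  The scalar field is an arbitrary type of class \<^class>\<open>real_normed_field\<close>.  By the
  Gelfand--Mazur theorem this means the reals or the complex numbers (with the usual
  absolute value), so both real and complex spaces are covered.
\<close>

definition seminorm :: "('k::real_normed_field \<Rightarrow> 'a::ab_group_add \<Rightarrow> 'a) \<Rightarrow> ('a \<Rightarrow> real) \<Rightarrow> bool" where
  "seminorm smul p \<longleftrightarrow>
     (\<forall>x y. p (x + y) \<le> p x + p y) \<and> (\<forall>c x. p (smul c x) = norm c * p x)"

text \<open>
  The Frechet space is the whole type \<^typ>\<open>'a\<close>, with the topology of its
  \<^class>\<open>topological_space\<close> instance.  This topology has to come from a separating
  sequence of seminorms with respect to which the space is (sequentially) complete.
\<close>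

definition frechet_space ::
    "('k::real_normed_field \<Rightarrow> 'a::{ab_group_add,topological_space} \<Rightarrow> 'a) \<Rightarrow> bool" where
  "frechet_space smul \<longleftrightarrow> vector_space smul \<and>
     (\<exists>p :: nat \<Rightarrow> 'a \<Rightarrow> real.
        (\<forall>n. seminorm smul (p n)) \<and>
        (\<forall>x. (\<forall>n. p n x = 0) \<longrightarrow> x = 0) \<and>
        (\<forall>U. open U \<longleftrightarrow> (\<forall>x\<in>U. \<exists>N. \<exists>e>0. {y. \<forall>n\<le>N. p n (y - x) < e} \<subseteq> U)) \<and>
        (\<forall>s :: nat \<Rightarrow> 'a.
           (\<forall>n. \<forall>e>0. \<exists>M. \<forall>i\<ge>M. \<forall>j\<ge>M. p n (s i - s j) < e) \<longrightarrow>
           (\<exists>l. \<forall>n. (\<lambda>i. p n (s i - l)) \<longlonglongrightarrow> 0)))"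

definition AP :: "nat set set" where
  "AP = {A. \<forall>m. \<exists>a k. k \<ge> 1 \<and> (\<forall>j\<le>m. a + j * k \<in> A)}"

text \<open>
  The dynamical notions are stated for a self-map of an abstract topology, since they are
  needed for the space itself, for its square and for its finite powers.  The time
  \<open>n = 0\<close> is included in orbits and return sets.
\<close>

definition return_set :: "('b \<Rightarrow> 'b) \<Rightarrow> 'b \<Rightarrow> 'b set \<Rightarrow> nat set" where
  "return_set R z U = {n. (R ^^ n) z \<in> U}"

definition hypercyclic :: "'b topology \<Rightarrow> ('b \<Rightarrow> 'b) \<Rightarrow> bool" where
  "hypercyclic Z R \<longleftrightarrow>
     (\<exists>z\<in>topspace Z. Z closure_of (range (\<lambda>n. (R ^^ n) z)) = topspace Z)"

definition AP_hypercyclic :: "'b topology \<Rightarrow> ('b \<Rightarrow> 'b) \<Rightarrow> bool" where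
  "AP_hypercyclic Z R \<longleftrightarrow>
     (\<exists>z\<in>topspace Z. \<forall>U. openin Z U \<and> U \<noteq> {} \<longrightarrow> return_set R z U \<in> AP)"

definition weakly_mixing :: "'b topology \<Rightarrow> ('b \<Rightarrow> 'b) \<Rightarrow> bool" where
  "weakly_mixing Z R \<longleftrightarrow> hypercyclic (prod_topology Z Z) (map_prod R R)"

definition multiply_recurrent :: "'b topology \<Rightarrow> ('b \<Rightarrow> 'b) \<Rightarrow> bool" where
  "multiply_recurrent Z R \<longleftrightarrow>
     (\<forall>U. openin Z U \<and> U \<noteq> {} \<longrightarrow>
        (\<forall>m::nat. \<exists>k\<ge>1. U \<inter> (\<Inter>j\<in>{1..m}. (R ^^ (k * j)) -` U) \<noteq> {}))"

text \<open>
  Strictly increasing sequences are identified with their ranges; a subsequence of \<open>n\<close> is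
  \<open>n \<circ> s\<close> for a strictly increasing \<open>s\<close>.
\<close>

definition hereditarily_AP_hypercyclic :: "'b topology \<Rightarrow> ('b \<Rightarrow> 'b) \<Rightarrow> bool" where
  "hereditarily_AP_hypercyclic Z R \<longleftrightarrow>
     (\<exists>n :: nat \<Rightarrow> nat. strict_mono n \<and> range n \<in> AP \<and>
        (\<forall>s :: nat \<Rightarrow> nat. strict_mono s \<and> range (n \<circ> s) \<in> AP \<longrightarrow>
           (\<exists>x\<in>topspace Z. \<forall>U. openin Z U \<and> U \<noteq> {} \<longrightarrow>
              return_set R x U \<inter> range (n \<circ> s) \<in> AP)))"

text \<open>
  The \<open>n\<close>-fold direct sum: its points are the families indexed by \<^term>\<open>{..<n}\<close>
  (functions equal to \<^const>\<open>undefined\<close> outside that set), with the product topology and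
  the coordinatewise action.
\<close>

definition power_space :: "nat \<Rightarrow> 'b topology \<Rightarrow> (nat \<Rightarrow> 'b) topology" where
  "power_space n Z = product_topology (\<lambda>_. Z) {..<n}"

definition power_map :: "nat \<Rightarrow> ('b \<Rightarrow> 'b) \<Rightarrow> (nat \<Rightarrow> 'b) \<Rightarrow> (nat \<Rightarrow> 'b)" where
  "power_map n R = (\<lambda>x. \<lambda>i\<in>{..<n}. R (x i))"

end

theory Submission
  imports Defs
begin

text \<open>
  All six conditions are compared with one topological property of \<open>T\<close>: any two
  pairs of nonempty open sets have a common return time (\<open>pair_transitive\<close>),
  and \<open>T\<close> is multiply recurrent. Call this property (H). For a weakly mixing
  \<open>T\<close> the return times come from a dense orbit of \<open>T \<oplus> T\<close>
  (\<open>weakly_mixing_imp_pair_transitive\<close>).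

  Under (H), a whole arithmetic progression of times carries \<open>U\<close> into
  \<open>V\<close>: send a point of \<open>U\<close> into \<open>V\<close> at some time
  \<open>a\<close>, and let multiple recurrence bring the open set \<open>U \<inter>
  T\<^bsup>-a\<^esup>(V)\<close> back to itself along \<open>c, 2c, \<dots>, mc\<close>.
  Furstenberg's argument refines finitely many pairs of open sets to one pair whose visiting
  times serve all of them at once (\<open>pair_transitive_common_pair\<close>), so one
  progression serves any finite number of pairs. Baire's theorem
  (\<open>generic_point\<close>) turns such statements about open sets into one point that
  works for every open set. This gives AP-hypercyclicity of all finite powers, the square
  included, and that of the square contains weak mixing and multiple recurrence. The
  condition with one source \<open>U\<close> and two targets is the case of two pairs with a
  common source, from which (H) can be recovered
  (\<open>pair_transitive_if_common_source\<close>).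

  For the criterion with dense sets \<open>X\<^sub>0\<close> and \<open>Y\<^sub>0\<close>,
  Baire's theorem gives one vector \<open>z\<close> with dense orbit and, for each
  \<open>k\<close>, a small vector \<open>u\<^sub>k\<close> and a progression of \<open>k +
  1\<close> times at which \<open>z\<close> is moved close to \<open>0\<close> and
  \<open>u\<^sub>k\<close> close to \<open>z\<close>. Since powers of \<open>T\<close>
  commute, the same happens to \<open>T\<^sup>i z\<close> and \<open>T\<^sup>i
  u\<^sub>k\<close>, so the orbit of \<open>z\<close> can play the role of both dense sets.

  Conversely, let the criterion hold along blocks of times. If the space is not trivial, the
  first elements of the blocks tend to infinity, so the blocks can be thinned out until
  every long progression in their union lies, up to its first term, in a single block
  (\<open>AP_in_sparse_blocks\<close>). Hence every set in \<open>AP\<close> contained in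
  the union has long progressions inside late blocks, along which the criterion sends
  \<open>x + \<Sum>\<^sub>j S\<^sub>k\<^sub>,\<^sub>j y\<close> from near \<open>x\<close>
  to near \<open>y\<close>, and Baire's theorem yields hereditary AP-hypercyclicity.

  Finally, hereditary AP-hypercyclicity gives (H) by applying it twice: take
  \<open>x\<close> in the first source that is generic along the given sequence, let
  \<open>B\<close> be the set of times at which \<open>x\<close> visits the first target,
  and take \<open>y\<close> in the second source that is generic along \<open>B\<close>. Any
  visit of \<open>y\<close> to the second target at a time in \<open>B\<close> is a common
  return time.
\<close>

section \<open>Arithmetic progressions\<close>

definition progression :: "nat \<Rightarrow> nat \<Rightarrow> nat \<Rightarrow> nat set" where
  "progression a c m = (\<lambda>j. a + j * c) ` {..m}"

lemma finite_progression: "finite (progression a c m)"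
  by (simp add: progression_def)

lemma AP_iff_progression: "A \<in> AP \<longleftrightarrow> (\<forall>m. \<exists>a c. c \<ge> 1 \<and> progression a c m \<subseteq> A)"
  by (simp add: AP_def progression_def image_subset_iff Ball_def)

lemma AP_mono: "A \<in> AP \<Longrightarrow> A \<subseteq> B \<Longrightarrow> B \<in> AP"
  unfolding AP_def by blast

text \<open>
  The first \<open>N\<close> terms of a progression of length \<open>m + N + 1\<close> can be discarded, and
  what remains lies beyond \<open>N\<close> because the common difference is at least \<open>1\<close>.
\<close>

lemma AP_late_progression:
  assumes "A \<in> AP"
  obtains a c where "a \<ge> N" "c \<ge> 1" "progression a c m \<subseteq> A"
proof -
  obtain a c where ac: "c \<ge> 1" "\<And>j. j \<le> m + N \<Longrightarrow> a + j * c \<in> A"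
    using assms unfolding AP_def by blast
  have "progression (a + N * c) c m \<subseteq> A"
    using ac(2)[of "N + _"] by (auto simp: progression_def algebra_simps)
  moreover have "a + N * c \<ge> N"
    using ac(1) by (metis mult_le_mono2 nat_mult_1_right trans_le_add2)
  ultimately show ?thesis
    using that ac(1) by blast
qed

lemma AP_unbounded:
  assumes "A \<in> AP"
  obtains n where "n \<in> A" "n \<ge> N"
  using AP_late_progression[OF assms, of N 0] by (auto simp: progression_def)

lemma AP_imp_infinite: "A \<in> AP \<Longrightarrow> infinite A"
  by (meson AP_unbounded infinite_nat_iff_unbounded_le)

section \<open>Simultaneous visits\<close>

definition sends :: "('b \<Rightarrow> 'b) \<Rightarrow> nat set \<Rightarrow> 'b set \<Rightarrow> 'b set \<Rightarrow> bool" where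
  "sends R D U V \<longleftrightarrow> (\<exists>x\<in>U. \<forall>d\<in>D. (R ^^ d) x \<in> V)"

text \<open>
  Topological transitivity of \<open>R \<oplus> R\<close>, expressed through boxes, so that only the topology
  of the space itself is mentioned.
\<close>

definition pair_transitive :: "('b::topological_space \<Rightarrow> 'b) \<Rightarrow> bool" where
  "pair_transitive R \<longleftrightarrow>
     (\<forall>U V U' V'. open U \<and> U \<noteq> {} \<and> open V \<and> V \<noteq> {} \<and>
        open U' \<and> U' \<noteq> {} \<and> open V' \<and> V' \<noteq> {} \<longrightarrow>
        (\<exists>n. sends R {n} U V \<and> sends R {n} U' V'))"

lemma pair_transitiveD:
  assumes "pair_transitive R" "open U" "U \<noteq> {}" "open V" "V \<noteq> {}"
    "open U'" "U' \<noteq> {}" "open V'" "V' \<noteq> {}"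
  obtains n where "sends R {n} U V" "sends R {n} U' V'"
  using assms unfolding pair_transitive_def by blast

lemma sends_singleton: "sends R {n} U V \<longleftrightarrow> U \<inter> (R ^^ n) -` V \<noteq> {}"
  by (auto simp: sends_def)

lemma continuous_on_funpow:
  fixes R :: "'b::topological_space \<Rightarrow> 'b"
  assumes "continuous_on UNIV R"
  shows "continuous_on UNIV (R ^^ n)"
proof (induction n)
  case (Suc n)
  then show ?case
    using continuous_on_compose[OF Suc.IH continuous_on_subset[OF assms]] by simp
qed (simp add: id_def)

lemma open_funpow_vimage:
  fixes R :: "'b::topological_space \<Rightarrow> 'b"
  assumes "continuous_on UNIV R" "open U"
  shows "open ((R ^^ n) -` U)"
  by (meson assms continuous_on_funpow open_vimage)

lemma funpow_commute_apply: "(R ^^ m) ((R ^^ n) x) = (R ^^ n) ((R ^^ m) x)"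
  by (metis add.commute comp_apply funpow_add)

text \<open>
  Furstenberg's refinement.  If \<open>n\<close> is a common return time from \<open>U'\<close> to \<open>U i\<close> and
  from \<open>V'\<close> to \<open>V i\<close>, replace the pair by \<open>U' \<inter> R\<^bsup>-n\<^esup>(U i)\<close> and
  \<open>V' \<inter> R\<^bsup>-n\<^esup>(V i)\<close>: a point \<open>x\<close> witnessing visits for the smaller pair also
  witnesses them for the old one, and \<open>R\<^sup>n x\<close> witnesses them for the new one at the same
  times.  The times \<open>D\<close> are a set rather than one number so that progressions are
  transported as a whole.
\<close>

lemma pair_transitive_common_pair:
  fixes R :: "'b::topological_space \<Rightarrow> 'b"
  assumes "pair_transitive R" "continuous_on UNIV R" "finite I"
    and "\<And>i. i \<in> I \<Longrightarrow> open (U i) \<and> U i \<noteq> {} \<and> open (V i) \<and> V i \<noteq> {}"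
  shows "\<exists>U' V'. open U' \<and> U' \<noteq> {} \<and> open V' \<and> V' \<noteq> {} \<and>
           (\<forall>D. sends R D U' V' \<longrightarrow> (\<forall>i\<in>I. sends R D (U i) (V i)))"
  using assms(3,4)
proof (induction I rule: finite_induct)
  case empty
  show ?case by (intro exI[of _ UNIV]) auto
next
  case (insert i I)
  have "\<exists>U' V'. open U' \<and> U' \<noteq> {} \<and> open V' \<and> V' \<noteq> {} \<and>
          (\<forall>D. sends R D U' V' \<longrightarrow> (\<forall>i\<in>I. sends R D (U i) (V i)))"
    using insert.prems by (intro insert.IH) blast
  then obtain U' V' where *: "open U'" "U' \<noteq> {}" "open V'" "V' \<noteq> {}"
    "\<And>D. sends R D U' V' \<Longrightarrow> \<forall>i\<in>I. sends R D (U i) (V i)"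
    by blast
  have i: "open (U i)" "U i \<noteq> {}" "open (V i)" "V i \<noteq> {}"
    using insert.prems by auto
  obtain n where n: "sends R {n} U' (U i)" "sends R {n} V' (V i)"
    using pair_transitiveD[OF assms(1) *(1,2) i(1,2) *(3,4) i(3,4)] by blast
  let ?U = "U' \<inter> (R ^^ n) -` U i" and ?V = "V' \<inter> (R ^^ n) -` V i"
  have "open ?U" "open ?V" "?U \<noteq> {}" "?V \<noteq> {}"
    using * i n open_funpow_vimage[OF assms(2)] by (auto simp: sends_singleton)
  moreover have "sends R D (U j) (V j)" if "sends R D ?U ?V" "j \<in> insert i I" for D j
  proof (cases "j = i")
    case True
    from that(1) obtain x where x: "x \<in> ?U" "\<forall>d\<in>D. (R ^^ d) x \<in> ?V"
      by (auto simp: sends_def)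
    then have "(R ^^ n) x \<in> U i" "\<forall>d\<in>D. (R ^^ d) ((R ^^ n) x) \<in> V i"
      by (auto simp: funpow_commute_apply[of _ R n])
    then show ?thesis
      unfolding True sends_def by blast
  next
    case False
    have "sends R D U' V'"
      using that(1) by (auto simp: sends_def)
    then show ?thesis
      using *(5) False that(2) by blast
  qed
  ultimately show ?case
    by (intro exI[of _ ?U] exI[of _ ?V]) blast
qed

text \<open>
  Multiple recurrence is applied to the set of points of \<open>U\<close> that reach \<open>V\<close> at time
  \<open>a\<close>: a point that revisits this set at the times \<open>c, \<dots>, mc\<close> reaches \<open>V\<close> at the
  times \<open>a, a + c, \<dots>, a + mc\<close>.
\<close>

lemma pair_transitive_recurrent_sends_progression:
  fixes R :: "'b::topological_space \<Rightarrow> 'b"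
  assumes "pair_transitive R" "multiply_recurrent euclidean R" "continuous_on UNIV R"
    and "open U" "U \<noteq> {}" "open V" "V \<noteq> {}"
  obtains a c where "c \<ge> 1" "sends R (progression a c m) U V"
proof -
  obtain a where a: "sends R {a} U V"
    using pair_transitiveD[OF assms(1,4-7,4-7)] by blast
  let ?W = "U \<inter> (R ^^ a) -` V"
  have "open ?W" "?W \<noteq> {}"
    using a assms(3,4,6) open_funpow_vimage by (auto simp: sends_singleton)
  then obtain c where c: "c \<ge> 1" and ne: "?W \<inter> (\<Inter>j\<in>{1..m}. (R ^^ (c * j)) -` ?W) \<noteq> {}"
    using assms(2) unfolding multiply_recurrent_def by (metis open_openin)
  obtain x where x: "x \<in> ?W" "\<And>j. j \<in> {1..m} \<Longrightarrow> (R ^^ (c * j)) x \<in> ?W"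
    using ne by blast
  have "(R ^^ (a + j * c)) x \<in> V" if "j \<le> m" for j
  proof (cases "j = 0")
    case False
    then have "(R ^^ (c * j)) x \<in> ?W"
      using x(2) that by simp
    then show ?thesis
      by (simp add: funpow_add mult.commute)
  qed (use x in auto)
  then have "sends R (progression a c m) U V"
    using x(1) by (auto simp: sends_def progression_def)
  then show ?thesis
    using that c by blast
qed

lemma simultaneous_progression:
  fixes R :: "'b::topological_space \<Rightarrow> 'b"
  assumes "pair_transitive R" "multiply_recurrent euclidean R" "continuous_on UNIV R" "finite I"
    and "\<And>i. i \<in> I \<Longrightarrow> open (U i) \<and> U i \<noteq> {} \<and> open (V i) \<and> V i \<noteq> {}"
  shows "\<exists>a c. c \<ge> 1 \<and> (\<forall>i\<in>I. sends R (progression a c m) (U i) (V i))"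
proof -
  obtain U' V' where *: "open U'" "U' \<noteq> {}" "open V'" "V' \<noteq> {}"
    and sends: "\<forall>D. sends R D U' V' \<longrightarrow> (\<forall>i\<in>I. sends R D (U i) (V i))"
    using pair_transitive_common_pair[OF assms(1,3,4), of U V] assms(5) by blast
  obtain a c where "c \<ge> 1" "sends R (progression a c m) U' V'"
    by (rule pair_transitive_recurrent_sends_progression[OF assms(1-3) *])
  then show ?thesis
    using sends by blast
qed

text \<open>
  Two pairs with different sources reduce to two pairs with the same one.  At a time \<open>n\<close>
  when \<open>U\<close> meets the preimages of both \<open>U'\<close> and \<open>V'\<close>, use the common source
  \<open>U \<inter> R\<^bsup>-n\<^esup>(U')\<close> with targets \<open>V\<close> and \<open>R\<^bsup>-n\<^esup>(V')\<close>; applying \<open>R\<^sup>n\<close> to the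
  second witness moves its source into \<open>U'\<close> and its target into \<open>V'\<close>.
\<close>

lemma pair_transitive_if_common_source:
  fixes R :: "'b::topological_space \<Rightarrow> 'b"
  assumes cont: "continuous_on UNIV R"
    and common: "\<And>U V V'. open U \<Longrightarrow> U \<noteq> {} \<Longrightarrow> open V \<Longrightarrow> V \<noteq> {} \<Longrightarrow> open V' \<Longrightarrow> V' \<noteq> {} \<Longrightarrow>
        \<exists>n. sends R {n} U V \<and> sends R {n} U V'"
  shows "pair_transitive R"
  unfolding pair_transitive_def
proof (intro allI impI, elim conjE)
  fix U V U' V' :: "'b set"
  assume o: "open U" "open V" "open U'" "open V'"
    and ne: "U \<noteq> {}" "V \<noteq> {}" "U' \<noteq> {}" "V' \<noteq> {}"
  obtain n where n: "sends R {n} U U'" "sends R {n} U V'"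
    using common[OF o(1) ne(1) o(3) ne(3) o(4) ne(4)] by blast
  let ?U = "U \<inter> (R ^^ n) -` U'" and ?V = "(R ^^ n) -` V'"
  have "open ?U" "?U \<noteq> {}" "open ?V" "?V \<noteq> {}"
    using n o open_funpow_vimage[OF cont] by (auto simp: sends_singleton)
  then obtain m where m: "sends R {m} ?U V" "sends R {m} ?U ?V"
    using common o(2) ne(2) by blast
  have "sends R {m} U V"
    using m(1) by (auto simp: sends_def)
  moreover have "sends R {m} U' V'"
    using m(2) by (auto simp: sends_def funpow_commute_apply[of n R m])
  ultimately show "\<exists>n. sends R {n} U V \<and> sends R {n} U' V'"
    by blast
qed

section \<open>Generic points\<close>

lemma continuous_map_funpow:
  assumes "continuous_map Z Z R"
  shows "continuous_map Z Z (R ^^ n)"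
proof (induction n)
  case (Suc n)
  then show ?case
    using continuous_map_compose[OF Suc.IH assms] by (simp only: funpow.simps)
qed simp

text \<open>
  The Baire argument behind every existence proof below.  For a target \<open>V\<close>, the points whose
  visits to \<open>V\<close> contain some member of \<open>F m\<close> form an open set, because the members are finite,
  and a dense one by hypothesis.  Taking \<open>F m\<close> to be the singletons produces dense orbits, and
  the progressions of length \<open>m + 1\<close> produce return sets in \<open>AP\<close>.  The targets range over a
  countable pi-base \<open>\<B>\<close>, which is easier to obtain for powers than second countability.  The
  family \<open>\<G>\<close> admits further generic requirements on the same point.
\<close>

lemma generic_point:
  fixes F :: "nat \<Rightarrow> nat set set"
  assumes Z: "completely_metrizable_space Z" "topspace Z \<noteq> {}"
    and R: "continuous_map Z Z R"
    and B: "countable \<B>" "\<And>B. B \<in> \<B> \<Longrightarrow> openin Z B \<and> B \<noteq> {}"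
      "\<And>U. openin Z U \<Longrightarrow> U \<noteq> {} \<Longrightarrow> \<exists>B\<in>\<B>. B \<subseteq> U"
    and G: "countable \<G>" "\<And>G. G \<in> \<G> \<Longrightarrow> openin Z G \<and> Z closure_of G = topspace Z"
    and fin: "\<And>m D. D \<in> F m \<Longrightarrow> finite D"
    and sends: "\<And>U V m. openin Z U \<Longrightarrow> U \<noteq> {} \<Longrightarrow> openin Z V \<Longrightarrow> V \<noteq> {} \<Longrightarrow> \<exists>D\<in>F m. sends R D U V"
  obtains z where "z \<in> topspace Z" "z \<in> \<Inter>\<G>"
    "\<And>V m. openin Z V \<Longrightarrow> V \<noteq> {} \<Longrightarrow> \<exists>D\<in>F m. \<forall>d\<in>D. (R ^^ d) z \<in> V"
proof -
  define H where "H V m = (\<Union>D\<in>F m. topspace Z \<inter> (\<Inter>d\<in>D. {x \<in> topspace Z. (R ^^ d) x \<in> V}))"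
    for V m
  have H_open: "openin Z (H V m)" if "openin Z V" for V m
    unfolding H_def
    using continuous_map_funpow[OF R] that
    by (intro openin_Union; clarsimp; intro openin_Int_Inter)
       (auto intro!: fin openin_continuous_map_preimage)
  have H_dense: "Z closure_of (H V m) = topspace Z" if "openin Z V" "V \<noteq> {}" for V m
  proof -
    have "H V m \<inter> U \<noteq> {}" if U: "openin Z U" "U \<noteq> {}" for U
    proof -
      obtain D x where "D \<in> F m" "x \<in> U" "\<forall>d\<in>D. (R ^^ d) x \<in> V"
        using sends[OF U \<open>openin Z V\<close> \<open>V \<noteq> {}\<close>, of m] unfolding sends_def by blast
      then have "x \<in> H V m"
        using openin_subset[OF U(1)] by (auto simp: H_def)
      then show ?thesis
        using \<open>x \<in> U\<close> by blast
    qed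
    then show ?thesis
      by (meson dense_intersects_open)
  qed
  define \<H> where "\<H> = \<G> \<union> (\<lambda>(B, m). H B m) ` (\<B> \<times> UNIV)"
  have "countable \<H>"
    using B(1) G(1) by (simp add: \<H>_def)
  then have "Z closure_of \<Inter>\<H> = topspace Z"
    using B(2) G(2) H_open H_dense
    by (intro Baire_category) (auto simp: \<H>_def Z)
  then have "topspace Z \<inter> \<Inter>\<H> \<noteq> {}"
    using Z(2) closure_of_restrict[of Z "\<Inter>\<H>"] by force
  then obtain z where z: "z \<in> topspace Z" "z \<in> \<Inter>\<H>"
    by blast
  have "\<exists>D\<in>F m. \<forall>d\<in>D. (R ^^ d) z \<in> V" if V: "openin Z V" "V \<noteq> {}" for V m
  proof -
    obtain B where "B \<in> \<B>" "B \<subseteq> V"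
      using B(3) V by blast
    then have "z \<in> H B m"
      using z(2) by (auto simp: \<H>_def)
    then show ?thesis
      using \<open>B \<subseteq> V\<close> unfolding H_def by blast
  qed
  then show ?thesis
    using that z by (auto simp: \<H>_def)
qed

lemma AP_generic_point:
  assumes Z: "completely_metrizable_space Z" "topspace Z \<noteq> {}"
    and R: "continuous_map Z Z R"
    and B: "countable \<B>" "\<And>B. B \<in> \<B> \<Longrightarrow> openin Z B \<and> B \<noteq> {}"
      "\<And>U. openin Z U \<Longrightarrow> U \<noteq> {} \<Longrightarrow> \<exists>B\<in>\<B>. B \<subseteq> U"
    and sends: "\<And>U V m. openin Z U \<Longrightarrow> U \<noteq> {} \<Longrightarrow> openin Z V \<Longrightarrow> V \<noteq> {} \<Longrightarrow>
        \<exists>a c. c \<ge> 1 \<and> progression a c m \<subseteq> A \<and> sends R (progression a c m) U V"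
  shows "\<exists>z\<in>topspace Z. \<forall>U. openin Z U \<and> U \<noteq> {} \<longrightarrow> return_set R z U \<inter> A \<in> AP"
proof -
  define F where "F m = {progression a c m | a c. c \<ge> 1 \<and> progression a c m \<subseteq> A}" for m
  obtain z where z: "z \<in> topspace Z"
    "\<And>V m. openin Z V \<Longrightarrow> V \<noteq> {} \<Longrightarrow> \<exists>D\<in>F m. \<forall>d\<in>D. (R ^^ d) z \<in> V"
  proof (rule generic_point[OF Z R B, where \<G> = "{}" and F = F])
    show "\<exists>D\<in>F m. sends R D U V"
      if "openin Z U" "U \<noteq> {}" "openin Z V" "V \<noteq> {}" for U V m
      using sends[OF that, of m] unfolding F_def by blast
  qed (auto simp: F_def finite_progression)
  have "return_set R z U \<inter> A \<in> AP" if "openin Z U" "U \<noteq> {}" for U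
    using z(2)[OF that] unfolding AP_iff_progression F_def return_set_def by blast
  then show ?thesis
    using z(1) by blast
qed

section \<open>Finite powers\<close>

lemma power_map_funpow:
  assumes "x \<in> {..<n} \<rightarrow>\<^sub>E UNIV"
  shows "(power_map n R ^^ d) x = (\<lambda>i\<in>{..<n}. (R ^^ d) (x i))"
proof (induction d)
  case 0
  then show ?case
    using PiE_restrict[OF assms] by (simp add: fun_eq_iff restrict_def)
next
  case (Suc d)
  then show ?case
    by (auto simp: power_map_def fun_eq_iff)
qed

lemma continuous_map_power_map:
  fixes R :: "'b::topological_space \<Rightarrow> 'b"
  assumes "continuous_on UNIV R"
  shows "continuous_map (power_space n euclidean) (power_space n euclidean) (power_map n R)"
proof -
  have "continuous_map (product_topology (\<lambda>_. euclidean) {..<n}) euclidean (\<lambda>x. R (x i))"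
    if "i < n" for i
  proof -
    have "continuous_map (product_topology (\<lambda>_. euclidean) {..<n}) euclidean (\<lambda>x. x i :: 'b)"
      by (rule continuous_map_product_projection) (simp add: that)
    moreover have "continuous_map euclidean euclidean R"
      using assms by simp
    ultimately have "continuous_map (product_topology (\<lambda>_. euclidean) {..<n}) euclidean (R \<circ> (\<lambda>x. x i))"
      by (rule continuous_map_compose)
    then show ?thesis
      by (simp only: comp_def)
  qed
  then show ?thesis
    unfolding power_space_def power_map_def continuous_map_componentwise
    by (auto cong: restrict_cong)
qed

lemma power_space_box:
  assumes "openin (power_space n euclidean) W" "W \<noteq> {}"
  obtains U where "\<And>i. i < n \<Longrightarrow> open (U i) \<and> U i \<noteq> {}" "PiE {..<n} U \<subseteq> W"
proof -
  obtain x where "x \<in> W"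
    using assms(2) by blast
  then obtain U where "\<forall>i\<in>{..<n}. open (U i)" "x \<in> PiE {..<n} U" "PiE {..<n} U \<subseteq> W"
    using assms(1) unfolding power_space_def openin_product_topology_alt by force
  then show ?thesis
    using that[of U] by (auto simp: PiE_iff)
qed

lemma power_space_openin_box:
  assumes "\<And>i. i < n \<Longrightarrow> open (U i)"
  shows "openin (power_space n euclidean) (PiE {..<n} U)"
proof -
  have "\<forall>i\<in>{..<n}. open (U i)"
    using assms by blast
  then show ?thesis
    unfolding power_space_def by (subst openin_PiE) simp_all
qed

text \<open>
  Open sets of the power contain boxes, and a box is a finite family of open sets of the base
  space; simultaneous progressions for such families give the hypothesis of the Baire argument
  on the power.
\<close>

lemma AP_hypercyclic_power:
  fixes R :: "'b::topological_space \<Rightarrow> 'b"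
  assumes complete: "completely_metrizable_space (euclidean :: 'b topology)"
    and B: "countable \<B>" "\<And>B. B \<in> \<B> \<Longrightarrow> open B \<and> B \<noteq> {}"
      "\<And>U :: 'b set. open U \<Longrightarrow> U \<noteq> {} \<Longrightarrow> \<exists>B\<in>\<B>. B \<subseteq> U"
    and R: "pair_transitive R" "multiply_recurrent euclidean R" "continuous_on UNIV R"
  shows "AP_hypercyclic (power_space n euclidean) (power_map n R)"
proof -
  let ?Z = "power_space n (euclidean :: 'b topology)" and ?R = "power_map n R"
  let ?\<B> = "PiE {..<n} ` (PiE {..<n} (\<lambda>_. \<B>))"
  have "\<exists>z\<in>topspace ?Z. \<forall>U. openin ?Z U \<and> U \<noteq> {} \<longrightarrow> return_set ?R z U \<inter> UNIV \<in> AP"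
  proof (rule AP_generic_point)
    show "completely_metrizable_space ?Z"
      unfolding power_space_def completely_metrizable_space_product_topology
      by (simp add: complete)
    show "topspace ?Z \<noteq> {}"
      by (simp add: power_space_def PiE_eq_empty_iff)
    show "continuous_map ?Z ?Z ?R"
      by (rule continuous_map_power_map[OF R(3)])
    show "countable ?\<B>"
      by (intro countable_image countable_PiE B) auto
    show "openin ?Z B \<and> B \<noteq> {}" if "B \<in> ?\<B>" for B
      using that B(2) by (fastforce simp: PiE_eq_empty_iff intro!: power_space_openin_box)
    show "\<exists>B\<in>?\<B>. B \<subseteq> W" if "openin ?Z W" "W \<noteq> {}" for W
    proof -
      obtain U where U: "\<And>i. i < n \<Longrightarrow> open (U i) \<and> U i \<noteq> {}" "PiE {..<n} U \<subseteq> W"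
        using power_space_box \<open>openin ?Z W\<close> \<open>W \<noteq> {}\<close> by blast
      have "\<forall>i\<in>{..<n}. \<exists>B\<in>\<B>. B \<subseteq> U i"
        using U(1) B(3) by simp
      then obtain f where f: "\<And>i. i < n \<Longrightarrow> f i \<in> \<B> \<and> f i \<subseteq> U i"
        by (metis lessThan_iff)
      let ?f = "\<lambda>i\<in>{..<n}. f i"
      have "PiE {..<n} ?f \<subseteq> W"
        using f by (intro order.trans[OF PiE_mono U(2)]) auto
      moreover have "PiE {..<n} ?f \<in> ?\<B>"
        using f by (intro imageI) auto
      ultimately show ?thesis
        by (rule bexI)
    qed
    show "\<exists>a c. c \<ge> 1 \<and> progression a c m \<subseteq> UNIV \<and> sends ?R (progression a c m) W W'"
      if W: "openin ?Z W" "W \<noteq> {}" and W': "openin ?Z W'" "W' \<noteq> {}" for W W' m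
    proof -
      obtain U where U: "\<And>i. i < n \<Longrightarrow> open (U i) \<and> U i \<noteq> {}" "PiE {..<n} U \<subseteq> W"
        using power_space_box W by blast
      obtain V where V: "\<And>i. i < n \<Longrightarrow> open (V i) \<and> V i \<noteq> {}" "PiE {..<n} V \<subseteq> W'"
        using power_space_box W' by blast
      obtain a c where c: "c \<ge> 1"
        and ac: "\<forall>i\<in>{..<n}. sends R (progression a c m) (U i) (V i)"
        using simultaneous_progression[OF R finite_lessThan, of n U V m] U(1) V(1) by force
      have "\<forall>i\<in>{..<n}. \<exists>x. x \<in> U i \<and> (\<forall>d\<in>progression a c m. (R ^^ d) x \<in> V i)"
        using ac unfolding sends_def by blast
      from bchoice[OF this] obtain x where x: "\<And>i. i < n \<Longrightarrow> x i \<in> U i"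
        "\<And>i d. i < n \<Longrightarrow> d \<in> progression a c m \<Longrightarrow> (R ^^ d) (x i) \<in> V i"
        by auto
      let ?x = "\<lambda>i\<in>{..<n}. x i"
      have "?x \<in> W"
        by (rule subsetD[OF U(2)]) (use x(1) in auto)
      moreover have "(?R ^^ d) ?x \<in> W'" if "d \<in> progression a c m" for d
      proof -
        have "(?R ^^ d) ?x = (\<lambda>i\<in>{..<n}. (R ^^ d) (x i))"
          by (subst power_map_funpow) auto
        also have "\<dots> \<in> PiE {..<n} V"
          using x(2) that by auto
        finally show ?thesis
          using V(2) by blast
      qed
      ultimately show ?thesis
        using c by (auto simp: sends_def)
    qed
  qed
  then show ?thesis
    by (simp add: AP_hypercyclic_def)
qed

text \<open>
  The square as a product of two factors and the power with index set \<open>{0, 1}\<close> differ only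
  in the representation of points.
\<close>

lemma AP_hypercyclic_square_of_power:
  fixes R :: "'b::topological_space \<Rightarrow> 'b"
  assumes "AP_hypercyclic (power_space 2 euclidean) (power_map 2 R)"
  shows "AP_hypercyclic (prod_topology euclidean euclidean) (map_prod R R)"
proof -
  obtain z where z: "z \<in> {..<2} \<rightarrow>\<^sub>E UNIV"
    "\<And>U. openin (power_space 2 euclidean) U \<Longrightarrow> U \<noteq> {} \<Longrightarrow> return_set (power_map 2 R) z U \<in> AP"
    using assms unfolding AP_hypercyclic_def by (auto simp: power_space_def)
  have "return_set (map_prod R R) (z 0, z 1) W \<in> AP"
    if W: "openin (prod_topology euclidean euclidean) W" "W \<noteq> {}" for W :: "('b \<times> 'b) set"
  proof -
    obtain p where "p \<in> W"
      using W(2) by blast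
    then obtain U V where UV: "open U" "open V" "U \<noteq> {}" "V \<noteq> {}" "U \<times> V \<subseteq> W"
      using W(1) unfolding openin_prod_topology_alt by (metis empty_iff open_openin surj_pair)
    let ?f = "\<lambda>i::nat. if i = 0 then U else V"
    have "return_set (power_map 2 R) z (PiE {..<2} ?f) \<in> AP"
      using UV by (intro z power_space_openin_box) (auto simp: PiE_eq_empty_iff)
    moreover have "return_set (power_map 2 R) z (PiE {..<2} ?f) \<subseteq> return_set (map_prod R R) (z 0, z 1) W"
    proof
      fix d assume "d \<in> return_set (power_map 2 R) z (PiE {..<2} ?f)"
      then have *: "(\<lambda>i\<in>{..<2::nat}. (R ^^ d) (z i)) \<in> PiE {..<2} ?f"
        by (simp add: return_set_def power_map_funpow[OF z(1)])
      have "(R ^^ d) (z 0) \<in> U" "(R ^^ d) (z 1) \<in> V"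
        using PiE_mem[OF *, of 0] PiE_mem[OF *, of 1] by auto
      moreover have "(map_prod R R ^^ d) (z 0, z 1) = ((R ^^ d) (z 0), (R ^^ d) (z 1))"
        by (induction d) auto
      ultimately show "d \<in> return_set (map_prod R R) (z 0, z 1) W"
        using UV(5) by (auto simp: return_set_def)
    qed
    ultimately show ?thesis
      by (rule AP_mono)
  qed
  then show ?thesis
    unfolding AP_hypercyclic_def by auto
qed

section \<open>Complete metrics on groups and Frechet spaces\<close>

text \<open>
  The Frechet topology enters the Baire arguments through a complete translation-invariant
  metric \<open>q (x - y)\<close>, in which approximate vectors can be added and subtracted.
\<close>

locale complete_F_norm =
  fixes q :: "'a::{ab_group_add,topological_space} \<Rightarrow> real"
  assumes q_zero_iff: "q x = 0 \<longleftrightarrow> x = 0"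
    and q_minus: "q (- x) = q x"
    and q_add: "q (x + y) \<le> q x + q y"
    and open_iff_q: "open U \<longleftrightarrow> (\<forall>x\<in>U. \<exists>e>0. \<forall>y. q (y - x) < e \<longrightarrow> y \<in> U)"
    and q_complete: "(\<And>e. e > 0 \<Longrightarrow> \<exists>M. \<forall>i\<ge>M. \<forall>j\<ge>M. q (s i - s j) < e) \<Longrightarrow>
      \<exists>l. (\<lambda>i::nat. q (s i - l)) \<longlonglongrightarrow> 0"
begin

lemma q_zero [simp]: "q 0 = 0"
  by (simp add: q_zero_iff)

lemma q_nonneg [simp]: "q x \<ge> 0"
  using q_add[of x "- x"] by (simp add: q_minus)

lemma q_commute: "q (x - y) = q (y - x)"
  using q_minus[of "x - y"] by simp

lemma q_triangle: "q (x - z) \<le> q (x - y) + q (y - z)"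
  using q_add[of "x - y" "y - z"] by simp

lemma open_q_ball: "open {y. q (y - x) < e}"
  unfolding open_iff_q
proof clarify
  fix y assume y: "q (y - x) < e"
  have "q (z - x) < e" if "q (z - y) < e - q (y - x)" for z
    using q_triangle[of z x y] that by simp
  then show "\<exists>r>0. \<forall>z. q (z - y) < r \<longrightarrow> z \<in> {y. q (y - x) < e}"
    using y by (intro exI[of _ "e - q (y - x)"]) auto
qed

lemma open_contains_q_ball:
  assumes "open U" "x \<in> U"
  obtains e where "e > 0" "{y. q (y - x) < e} \<subseteq> U"
proof -
  obtain e where "e > 0" "\<forall>y. q (y - x) < e \<longrightarrow> y \<in> U"
    using assms unfolding open_iff_q by blast
  then show ?thesis
    by (intro that[of e]) auto
qed

lemma tendsto_iff_q: "(f \<longlongrightarrow> l) F \<longleftrightarrow> (\<forall>e>0. \<forall>\<^sub>F x in F. q (f x - l) < e)"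
proof
  assume lim: "(f \<longlongrightarrow> l) F"
  show "\<forall>e>0. \<forall>\<^sub>F x in F. q (f x - l) < e"
    using topological_tendstoD[OF lim open_q_ball] by simp
next
  assume *: "\<forall>e>0. \<forall>\<^sub>F x in F. q (f x - l) < e"
  show "(f \<longlongrightarrow> l) F"
  proof (rule topological_tendstoI)
    fix U assume "open U" "l \<in> U"
    then obtain e where e: "e > 0" "{y. q (y - l) < e} \<subseteq> U"
      by (rule open_contains_q_ball)
    have "\<forall>\<^sub>F x in F. q (f x - l) < e"
      using * e(1) by blast
    then show "\<forall>\<^sub>F x in F. f x \<in> U"
      by (rule eventually_mono) (use e(2) in blast)
  qed
qed

lemma completely_metrizable_euclidean: "completely_metrizable_space (euclidean :: 'a topology)"
proof -
  interpret M: Metric_space "UNIV :: 'a set" "\<lambda>x y. q (x - y)"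
    by unfold_locales (auto simp: q_commute q_triangle q_zero_iff)
  have top: "M.mtopology = euclidean"
    unfolding topology_eq M.openin_mtopology M.mball_def open_openin[symmetric]
    by (auto simp: open_iff_q q_commute subset_iff)
  have "\<exists>l. limitin M.mtopology s l sequentially" if "M.MCauchy s" for s
  proof -
    have "\<exists>M. \<forall>i\<ge>M. \<forall>j\<ge>M. q (s i - s j) < e" if "e > 0" for e
      using \<open>M.MCauchy s\<close> that unfolding M.MCauchy_def by meson
    then obtain l where "(\<lambda>i. q (s i - l)) \<longlonglongrightarrow> 0"
      using q_complete[of s] by blast
    then show ?thesis
      by (auto simp: M.limitin_metric_dist_null)
  qed
  then have "M.mcomplete"
    by (simp add: M.mcomplete_def)
  then show ?thesis
    using M.completely_metrizable_space_mtopology top by simp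
qed

lemma countable_pi_base:
  assumes "separable_space (euclidean :: 'a topology)"
  shows "\<exists>\<B>. countable \<B> \<and> (\<forall>B\<in>\<B>. open B \<and> B \<noteq> {}) \<and>
           (\<forall>U :: 'a set. open U \<and> U \<noteq> {} \<longrightarrow> (\<exists>B\<in>\<B>. B \<subseteq> U))"
proof -
  obtain C where C: "countable C" "closure C = (UNIV :: 'a set)"
    using assms unfolding separable_space_def by auto
  let ?ball = "\<lambda>(c, n). {y. q (y - c) < inverse (real (Suc n))}"
  let ?\<B> = "?ball ` (C \<times> UNIV)"
  have "countable ?\<B>"
    using C(1) by simp
  moreover have "open B \<and> B \<noteq> {}" if B: "B \<in> ?\<B>" for B
  proof -
    obtain c n where "B = ?ball (c, n)"
      using B by auto
    moreover have "c \<in> ?ball (c, n)"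
      by simp
    moreover have "open (?ball (c, n))"
      by (simp add: open_q_ball)
    ultimately show ?thesis
      by blast
  qed
  moreover have "\<exists>B\<in>?\<B>. B \<subseteq> U" if U: "open U" "U \<noteq> {}" for U
  proof -
    obtain x where "x \<in> U"
      using U(2) by blast
    then obtain e where e: "e > 0" "{y. q (y - x) < e} \<subseteq> U"
      using open_contains_q_ball U(1) by blast
    obtain n where n: "inverse (real (Suc n)) < e / 2"
      using reals_Archimedean[of "e / 2"] e(1) by auto
    let ?U = "{y. q (y - x) < inverse (real (Suc n))}"
    have "x \<in> ?U"
      by simp
    then have "C \<inter> ?U \<noteq> {}"
      using open_Int_closure_eq_empty[OF open_q_ball, of x "inverse (real (Suc n))" C] C(2) by blast
    then obtain c where c: "c \<in> C" "q (c - x) < inverse (real (Suc n))"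
      by blast
    have "?ball (c, n) \<subseteq> {y. q (y - x) < e}"
    proof clarsimp
      fix y assume "q (y - c) < inverse (1 + real n)"
      then show "q (y - x) < e"
        using q_triangle[of y x c] c(2) n by simp
    qed
    then have "?ball (c, n) \<subseteq> U"
      using e(2) by (rule order_trans)
    moreover have "?ball (c, n) \<in> ?\<B>"
      using c(1) by (intro imageI) simp
    ultimately show ?thesis
      by (rule bexI)
  qed
  ultimately show ?thesis
    by (intro exI[of _ ?\<B>]) blast
qed

end

text \<open>
  The seminorms are combined into the F-norm \<open>q x = sup\<^sub>n min (1/(n+1)) (p\<^sub>n x)\<close>.  Since the
  cut-off levels decrease to \<open>0\<close>, smallness of \<open>q\<close> means smallness of finitely many \<open>p\<^sub>n\<close>.
  Multiplying a nonzero vector by small scalars gives nonzero vectors of arbitrarily small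
  F-norm, which is how the absence of isolated points is recorded.
\<close>

lemma frechet_space_F_norm:
  fixes smul :: "'k::real_normed_field \<Rightarrow> 'a::{ab_group_add,topological_space} \<Rightarrow> 'a"
  assumes "frechet_space smul"
  shows "\<exists>q :: 'a \<Rightarrow> real. complete_F_norm q \<and>
           ((\<exists>x :: 'a. x \<noteq> 0) \<longrightarrow> (\<forall>e>0. \<exists>y. y \<noteq> 0 \<and> q y < e))"
proof -
  interpret V: vector_space smul
    using assms unfolding frechet_space_def by (rule conjunct1)
  obtain p :: "nat \<Rightarrow> 'a \<Rightarrow> real"
    where p: "\<forall>n. seminorm smul (p n)" "\<forall>x. (\<forall>n. p n x = 0) \<longrightarrow> x = 0"
      and open_p: "\<forall>U. open U \<longleftrightarrow> (\<forall>x\<in>U. \<exists>N. \<exists>e>0. {y. \<forall>n\<le>N. p n (y - x) < e} \<subseteq> U)"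
      and complete_p: "\<forall>s :: nat \<Rightarrow> 'a. (\<forall>n. \<forall>e>0. \<exists>M. \<forall>i\<ge>M. \<forall>j\<ge>M. p n (s i - s j) < e) \<longrightarrow>
           (\<exists>l. \<forall>n. (\<lambda>i. p n (s i - l)) \<longlonglongrightarrow> 0)"
    using assms unfolding frechet_space_def by (elim conjE exE)
  have p_add: "p n (x + y) \<le> p n x + p n y" and p_smul: "p n (smul c x) = norm c * p n x" for n x y c
    using p(1) by (auto simp: seminorm_def)
  have p_zero: "p n 0 = 0" for n
    using p_smul[of n 0 0] by simp
  have p_minus: "p n (- x) = p n x" for n x
    using p_smul[of n "-1" x] by simp
  have p_nonneg: "p n x \<ge> 0" for n x
    using p_add[of n x "- x"] by (simp add: p_minus p_zero)

  define t where "t n x = min (inverse (real (Suc n))) (p n x)" for n x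
  define q where "q x = (SUP n. t n x)" for x
  have t_nonneg: "t n x \<ge> 0" for n x
    by (simp add: t_def p_nonneg)
  have "t n x \<le> 1" for n x
    by (simp add: t_def min_le_iff_disj inverse_le_1_iff)
  then have bdd: "bdd_above (range (\<lambda>n. t n x))" for x
    by (intro bdd_aboveI) auto
  have t_le_q: "t n x \<le> q x" for n x
    unfolding q_def by (rule cSUP_upper[OF _ bdd]) simp
  have q_le: "q x \<le> e" if "\<And>n. t n x \<le> e" for x e
    unfolding q_def by (rule cSUP_least) (auto intro: that)
  have q_from_p: "q x \<le> e" if N: "inverse (real (Suc N)) \<le> e" and p: "\<And>n. n \<le> N \<Longrightarrow> p n x \<le> e" for x N e
  proof (rule q_le)
    fix n
    show "t n x \<le> e"
    proof (cases "n \<le> N")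
      case True
      then show ?thesis
        using p[of n] by (simp add: t_def)
    next
      case False
      then have "inverse (real (Suc n)) \<le> inverse (real (Suc N))"
        by (intro le_imp_inverse_le) auto
      then show ?thesis
        using N unfolding t_def by (meson min.cobounded1 order_trans)
    qed
  qed
  have p_from_q: "p n x < e" if "q x < e" "e \<le> inverse (real (Suc N))" "n \<le> N" for n x e N
  proof -
    have "inverse (real (Suc N)) \<le> inverse (real (Suc n))"
      using that(3) by (intro le_imp_inverse_le) auto
    then have "e \<le> inverse (real (Suc n))"
      using that(2) by (rule order_trans[rotated])
    moreover have "t n x < e"
      using t_le_q that(1) by (rule le_less_trans)
    ultimately show ?thesis
      unfolding t_def by linarith
  qed
  have small: "\<exists>N. inverse (real (Suc N)) \<le> e" if "e > 0" for e
    using reals_Archimedean[OF that] by (auto intro: less_imp_le)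

  have "complete_F_norm q"
  proof
    show "q x = 0 \<longleftrightarrow> x = 0" for x
    proof
      assume "q x = 0"
      then have "t n x = 0" for n
        using t_le_q[of n x] t_nonneg[of n x] by simp
      then have "p n x = 0" for n
        unfolding t_def min_def by (metis inverse_eq_imp_eq inverse_zero of_nat_eq_0_iff nat.distinct(1))
      then show "x = 0"
        using p(2) by blast
    next
      assume "x = 0"
      then have "t n x = 0" for n
        by (simp add: t_def p_zero)
      then show "q x = 0"
        by (simp add: q_def)
    qed
    show "q (- x) = q x" for x
      by (simp add: q_def t_def p_minus)
    show "q (x + y) \<le> q x + q y" for x y
    proof (rule q_le)
      fix n
      have "t n (x + y) \<le> t n x + t n y"
        using p_add[of n x y] p_nonneg[of n x] p_nonneg[of n y]
          inverse_nonnegative_iff_nonnegative[of "real (Suc n)"]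
        unfolding t_def by linarith
      also have "\<dots> \<le> q x + q y"
        by (intro add_mono t_le_q)
      finally show "t n (x + y) \<le> q x + q y" .
    qed
    show "open U \<longleftrightarrow> (\<forall>x\<in>U. \<exists>e>0. \<forall>y. q (y - x) < e \<longrightarrow> y \<in> U)" for U
    proof -
      have "(\<exists>N. \<exists>e>0. {y. \<forall>n\<le>N. p n (y - x) < e} \<subseteq> U) \<longleftrightarrow> (\<exists>e>0. \<forall>y. q (y - x) < e \<longrightarrow> y \<in> U)" for x
      proof
        assume "\<exists>N. \<exists>e>0. {y. \<forall>n\<le>N. p n (y - x) < e} \<subseteq> U"
        then obtain N e where Ne: "e > 0" "{y. \<forall>n\<le>N. p n (y - x) < e} \<subseteq> U"
          by blast
        let ?e = "min e (inverse (real (Suc N)))"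
        have "y \<in> U" if "q (y - x) < ?e" for y
        proof -
          have "p n (y - x) < e" if "n \<le> N" for n
            using p_from_q[OF \<open>q (y - x) < ?e\<close> _ that] by simp
          then show ?thesis
            using Ne(2) by blast
        qed
        moreover have "?e > 0"
          using Ne(1) by simp
        ultimately show "\<exists>e>0. \<forall>y. q (y - x) < e \<longrightarrow> y \<in> U"
          by blast
      next
        assume "\<exists>e>0. \<forall>y. q (y - x) < e \<longrightarrow> y \<in> U"
        then obtain e where e: "e > 0" "\<And>y. q (y - x) < e \<Longrightarrow> y \<in> U"
          by blast
        obtain N where N: "inverse (real (Suc N)) \<le> e / 2"
          using small[of "e / 2"] e(1) by auto
        have "{y. \<forall>n\<le>N. p n (y - x) < e / 2} \<subseteq> U"
        proof clarify
          fix y assume "\<forall>n\<le>N. p n (y - x) < e / 2"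
          then have "q (y - x) \<le> e / 2"
            by (intro q_from_p[OF N]) (auto intro: less_imp_le)
          then show "y \<in> U"
            using e by simp
        qed
        then show "\<exists>N. \<exists>e>0. {y. \<forall>n\<le>N. p n (y - x) < e} \<subseteq> U"
          using e(1) by (intro exI[of _ N] exI[of _ "e / 2"]) simp
      qed
      then show ?thesis
        by (simp add: open_p)
    qed
    show "\<exists>l. (\<lambda>i. q (s i - l)) \<longlonglongrightarrow> 0"
      if Cauchy: "\<And>e. e > 0 \<Longrightarrow> \<exists>M. \<forall>i\<ge>M. \<forall>j\<ge>M. q (s i - s j) < e" for s :: "nat \<Rightarrow> 'a"
    proof -
      have "\<exists>M. \<forall>i\<ge>M. \<forall>j\<ge>M. p n (s i - s j) < e" if "e > 0" for n e
      proof -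
        let ?e = "min e (inverse (real (Suc n)))"
        obtain M where "\<forall>i\<ge>M. \<forall>j\<ge>M. q (s i - s j) < ?e"
          using Cauchy[of ?e] \<open>e > 0\<close> by auto
        then have "\<forall>i\<ge>M. \<forall>j\<ge>M. p n (s i - s j) < ?e"
          using p_from_q[of _ ?e n n] by auto
        then show ?thesis
          by auto
      qed
      then obtain l where l: "\<And>n. (\<lambda>i. p n (s i - l)) \<longlonglongrightarrow> 0"
        using complete_p[rule_format, of s] by blast
      have "(\<lambda>i. q (s i - l)) \<longlonglongrightarrow> 0"
      proof (rule order_tendstoI)
        fix e :: real assume "e > 0"
        then obtain N where N: "inverse (real (Suc N)) \<le> e / 2"
          using small[of "e / 2"] by auto
        have "\<forall>\<^sub>F i in sequentially. \<forall>n\<in>{..N}. p n (s i - l) < e / 2"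
          using order_tendstoD(2)[OF l, of "e / 2"] \<open>e > 0\<close> by (intro eventually_ball_finite) auto
        then show "\<forall>\<^sub>F i in sequentially. q (s i - l) < e"
        proof eventually_elim
          case (elim i)
          then have "q (s i - l) \<le> e / 2"
            by (intro q_from_p[OF N]) (auto intro: less_imp_le)
          then show ?case
            using \<open>e > 0\<close> by simp
        qed
      next
        fix e :: real assume "e < 0"
        then show "\<forall>\<^sub>F i in sequentially. e < q (s i - l)"
          by (intro always_eventually allI less_le_trans[OF _ order_trans[OF t_nonneg t_le_q]])
      qed
      then show ?thesis
        by blast
    qed
  qed
  moreover have "\<exists>y. y \<noteq> 0 \<and> q y < e" if "x \<noteq> 0" "e > 0" for x :: 'a and e
  proof -
    obtain N where N: "inverse (real (Suc N)) \<le> e / 2"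
      using small[of "e / 2"] \<open>e > 0\<close> by auto
    define c where "c = (e / 2) / (1 + (\<Sum>n\<le>N. p n x))"
    have "(\<Sum>n\<le>N. p n x) \<ge> 0"
      by (intro sum_nonneg p_nonneg)
    then have S: "1 + (\<Sum>n\<le>N. p n x) > 0"
      by linarith
    then have "c > 0"
      using \<open>e > 0\<close> by (simp add: c_def)
    have "p n (smul (of_real c) x) \<le> e / 2" if "n \<le> N" for n
    proof -
      have "p n x \<le> 1 + (\<Sum>n\<le>N. p n x)"
        using member_le_sum[of n "{..N}" "\<lambda>n. p n x"] that p_nonneg by simp
      then have "c * p n x \<le> c * (1 + (\<Sum>n\<le>N. p n x))"
        using \<open>c > 0\<close> by simp
      also have "\<dots> = e / 2"
        using S unfolding c_def by (metis less_irrefl nonzero_eq_divide_eq)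
      finally show ?thesis
        using \<open>c > 0\<close> by (simp add: p_smul)
    qed
    then have "q (smul (of_real c) x) \<le> e / 2"
      by (intro q_from_p[OF N])
    moreover have "smul (of_real c) x \<noteq> 0"
      using \<open>c > 0\<close> \<open>x \<noteq> 0\<close> by simp
    ultimately show ?thesis
      using \<open>e > 0\<close> by (intro exI[of _ "smul (of_real c) x"]) simp
  qed
  ultimately show ?thesis
    by blast
qed

section \<open>Recovering mixing and recurrence\<close>

text \<open>
  A visit along \<open>a + jc\<close> of any point \<open>x\<close>, whether or not \<open>x\<close> lies in \<open>U\<close>, shows
  recurrence of \<open>R\<^sup>a x\<close>, which does lie in \<open>U\<close>.
\<close>

lemma multiply_recurrent_if_progressions:
  fixes R :: "'b::topological_space \<Rightarrow> 'b"
  assumes "\<And>U m. open U \<Longrightarrow> U \<noteq> {} \<Longrightarrow> \<exists>x a c. c \<ge> 1 \<and> (\<forall>d\<in>progression a c m. (R ^^ d) x \<in> U)"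
  shows "multiply_recurrent euclidean R"
  unfolding multiply_recurrent_def
proof (intro allI impI, elim conjE)
  fix U :: "'b set" and m :: nat
  assume "openin euclidean U" "U \<noteq> {}"
  then obtain x a c where c: "c \<ge> 1" and *: "\<And>j. j \<le> m \<Longrightarrow> (R ^^ (a + j * c)) x \<in> U"
    using assms[of U m] by (auto simp: progression_def)
  have "(R ^^ (c * j)) ((R ^^ a) x) \<in> U" if "j \<le> m" for j
    using *[OF that] by (metis add.commute comp_apply funpow_add mult.commute)
  moreover from this[of 0] have "(R ^^ a) x \<in> U"
    by simp
  ultimately have "(R ^^ a) x \<in> U \<inter> (\<Inter>j\<in>{1..m}. (R ^^ (c * j)) -` U)"
    by auto
  then show "\<exists>k\<ge>1. U \<inter> (\<Inter>j\<in>{1..m}. (R ^^ (k * j)) -` U) \<noteq> {}"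
    using c by blast
qed

lemma multiply_recurrent_if_AP_return_set:
  fixes R :: "'b::topological_space \<Rightarrow> 'b"
  assumes "\<And>U. open U \<Longrightarrow> U \<noteq> {} \<Longrightarrow> return_set R x U \<in> AP"
  shows "multiply_recurrent euclidean R"
proof (rule multiply_recurrent_if_progressions)
  fix U :: "'b set" and m :: nat
  assume "open U" "U \<noteq> {}"
  then obtain a c where "c \<ge> 1" "progression a c m \<subseteq> return_set R x U"
    using assms unfolding AP_iff_progression by blast
  then show "\<exists>x a c. c \<ge> 1 \<and> (\<forall>d\<in>progression a c m. (R ^^ d) x \<in> U)"
    unfolding return_set_def by blast
qed

lemma map_prod_funpow:
  fixes R :: "'b \<Rightarrow> 'b"
  shows "(map_prod R R ^^ n) (x, y) = ((R ^^ n) x, (R ^^ n) y)"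
  by (induction n) auto

lemma AP_hypercyclic_square_imp:
  fixes R :: "'b::topological_space \<Rightarrow> 'b"
  assumes "AP_hypercyclic (prod_topology euclidean euclidean) (map_prod R R)"
  shows "weakly_mixing euclidean R \<and> multiply_recurrent euclidean R"
proof
  let ?Z = "prod_topology euclidean euclidean :: ('b \<times> 'b) topology"
  obtain z where z: "z \<in> topspace ?Z"
    "\<And>W. openin ?Z W \<Longrightarrow> W \<noteq> {} \<Longrightarrow> return_set (map_prod R R) z W \<in> AP"
    using assms unfolding AP_hypercyclic_def by blast
  have "range (\<lambda>n. (map_prod R R ^^ n) z) \<inter> W \<noteq> {}" if W: "openin ?Z W" "W \<noteq> {}" for W
  proof -
    obtain n where "n \<in> return_set (map_prod R R) z W"
      by (rule AP_unbounded[OF z(2)[OF W]])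
    then show ?thesis
      by (auto simp: return_set_def)
  qed
  then have "?Z closure_of range (\<lambda>n. (map_prod R R ^^ n) z) = topspace ?Z"
    unfolding dense_intersects_open by blast
  then show "weakly_mixing euclidean R"
    using z(1) unfolding weakly_mixing_def hypercyclic_def by blast
  show "multiply_recurrent euclidean R"
  proof (rule multiply_recurrent_if_AP_return_set)
    fix U :: "'b set" assume U: "open U" "U \<noteq> {}"
    have "return_set (map_prod R R) (fst z, snd z) (U \<times> UNIV) \<in> AP"
      using z(2)[of "U \<times> UNIV"] U by (simp add: open_Times)
    then show "return_set R (fst z) U \<in> AP"
      unfolding return_set_def map_prod_funpow by simp
  qed
qed

text \<open>
  Sets in \<open>AP\<close> are infinite, so the indices of their elements can be enumerated increasingly.
\<close>

lemma AP_subset_subsequence: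
  fixes n :: "nat \<Rightarrow> nat"
  assumes "B \<in> AP" "B \<subseteq> range n"
  obtains s :: "nat \<Rightarrow> nat" where "strict_mono s" "range (n \<circ> s) = B"
proof -
  have B: "B = n ` (n -` B)"
    using assms(2) by blast
  then have "infinite (n -` B)"
    using AP_imp_infinite[OF assms(1)] by (metis finite_imageI)
  then have "strict_mono (enumerate (n -` B))" "range (enumerate (n -` B)) = n -` B"
    by (simp_all add: strict_mono_enumerate range_enumerate)
  then show ?thesis
    using that[of "enumerate (n -` B)"] B by (metis image_comp)
qed

text \<open>
  The second generic point is taken along the times at which the first one visits its target, so
  every visit it makes to its own target is a common return time.
\<close>

lemma hereditarily_AP_hypercyclic_imp:
  fixes R :: "'b::topological_space \<Rightarrow> 'b"
  assumes "hereditarily_AP_hypercyclic euclidean R" and cont: "continuous_on UNIV R"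
  shows "pair_transitive R \<and> multiply_recurrent euclidean R"
proof -
  obtain n :: "nat \<Rightarrow> nat" where n: "range n \<in> AP"
    and sub: "\<forall>s :: nat \<Rightarrow> nat. strict_mono s \<and> range (n \<circ> s) \<in> AP \<longrightarrow>
        (\<exists>x\<in>topspace euclidean. \<forall>U. openin euclidean U \<and> U \<noteq> {} \<longrightarrow>
            return_set R x U \<inter> range (n \<circ> s) \<in> AP)"
    using assms(1) unfolding hereditarily_AP_hypercyclic_def by blast
  have generic: "\<exists>x. \<forall>U. open U \<and> U \<noteq> {} \<longrightarrow> return_set R x U \<inter> A \<in> AP"
    if A: "A \<in> AP" "A \<subseteq> range n" for A
  proof -
    obtain s :: "nat \<Rightarrow> nat" where s: "strict_mono s" "range (n \<circ> s) = A"
      by (rule AP_subset_subsequence[OF A])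
    have "\<exists>x\<in>topspace euclidean. \<forall>U. openin euclidean U \<and> U \<noteq> {} \<longrightarrow>
        return_set R x U \<inter> range (n \<circ> s) \<in> AP"
      using sub s A(1) by blast
    then show ?thesis
      unfolding s(2) by simp
  qed
  \<comment> \<open>A generic point can be moved into any \<open>U\<close>: an iterate of \<open>x\<close> lies in \<open>U\<close>,
      and it is again generic because preimages of nonempty open sets are nonempty,
      as visits occur after any given time.\<close>
  have generic_in: "\<exists>x\<in>U. \<forall>V. open V \<and> V \<noteq> {} \<longrightarrow> return_set R x V \<inter> A \<in> AP"
    if A: "A \<in> AP" "A \<subseteq> range n" and U: "open U" "U \<noteq> {}" for A U
  proof -
    obtain x where x: "\<And>V. open V \<Longrightarrow> V \<noteq> {} \<Longrightarrow> return_set R x V \<inter> A \<in> AP"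
      using generic[OF A] by blast
    obtain i where i: "(R ^^ i) x \<in> U"
      using AP_unbounded[OF x[OF U], of 0] by (auto simp: return_set_def)
    have "return_set R ((R ^^ i) x) V \<inter> A \<in> AP" if V: "open V" "V \<noteq> {}" for V
    proof -
      obtain d where d: "d \<ge> i" "(R ^^ d) x \<in> V"
        using AP_unbounded[OF x[OF V], of i] by (auto simp: return_set_def)
      then have "(R ^^ i) ((R ^^ (d - i)) x) \<in> V"
        by (metis comp_apply funpow_add le_add_diff_inverse)
      then have "(R ^^ i) -` V \<noteq> {}"
        by blast
      then have "return_set R x ((R ^^ i) -` V) \<inter> A \<in> AP"
        by (intro x open_funpow_vimage cont V)
      moreover have "return_set R x ((R ^^ i) -` V) = return_set R ((R ^^ i) x) V"
        by (simp add: return_set_def funpow_commute_apply[of i R])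
      ultimately show ?thesis
        by simp
    qed
    then show ?thesis
      using i by blast
  qed
  have "pair_transitive R"
    unfolding pair_transitive_def
  proof (intro allI impI, elim conjE)
    fix U V U' V' :: "'b set"
    assume o: "open U" "open V" "open U'" "open V'"
      and ne: "U \<noteq> {}" "V \<noteq> {}" "U' \<noteq> {}" "V' \<noteq> {}"
    obtain x where x: "x \<in> U" "return_set R x V \<inter> range n \<in> AP"
      using generic_in[OF n order_refl o(1) ne(1)] o(2) ne(2) by blast
    obtain y where y: "y \<in> U'" "return_set R y V' \<inter> (return_set R x V \<inter> range n) \<in> AP"
      using generic_in[OF x(2) Int_lower2 o(3) ne(3)] o(4) ne(4) by blast
    obtain d where "(R ^^ d) x \<in> V" "(R ^^ d) y \<in> V'"
      using AP_unbounded[OF y(2)] by (auto simp: return_set_def)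
    then show "\<exists>n. sends R {n} U V \<and> sends R {n} U' V'"
      using x(1) y(1) by (auto simp: sends_def)
  qed
  moreover obtain x where x: "\<forall>U. open U \<and> U \<noteq> {} \<longrightarrow> return_set R x U \<inter> range n \<in> AP"
    using generic[OF n order_refl] by blast
  have "multiply_recurrent euclidean R"
  proof (rule multiply_recurrent_if_AP_return_set)
    fix U :: "'b set" assume "open U" "U \<noteq> {}"
    then have "return_set R x U \<inter> range n \<in> AP"
      using x by blast
    then show "return_set R x U \<in> AP"
      by (rule AP_mono) (rule Int_lower1)
  qed
  ultimately show ?thesis
    by blast
qed

section \<open>Progressions in sparse unions of blocks\<close>

text \<open>
  If every block lies beyond twice the previous ones, then consecutive terms \<open>s < t \<le> 2 s\<close>
  cannot lie in different blocks.  The terms \<open>e j = a + jc\<close> of a progression satisfy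
  \<open>e (j + 1) \<le> 2 * e j\<close> for \<open>j \<ge> 1\<close>, so only the very first term may fall outside the
  common block.
\<close>

lemma AP_in_sparse_blocks:
  fixes P :: "nat \<Rightarrow> nat set"
  assumes sep: "\<And>i i' s t. i < i' \<Longrightarrow> s \<in> P i \<Longrightarrow> t \<in> P i' \<Longrightarrow> 2 * s < t"
    and fin: "\<And>i. finite (P i)"
    and B: "B \<in> AP" "B \<subseteq> (\<Union>i. P i)"
  shows "\<exists>i\<ge>K. \<exists>a c. c \<ge> 1 \<and> progression a c m \<subseteq> B \<inter> P i"
proof -
  have "finite (\<Union>i<K. P i)"
    using fin by simp
  then obtain N where N: "\<And>s. s \<in> (\<Union>i<K. P i) \<Longrightarrow> s < N"
    unfolding finite_nat_set_iff_bounded by blast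
  obtain a c where ac: "a \<ge> N" "c \<ge> 1" "progression a c (Suc m) \<subseteq> B"
    by (rule AP_late_progression[OF B(1)])
  define e where "e j = a + j * c" for j
  have e_B: "e j \<in> B" if "j \<le> Suc m" for j
    using ac(3) that by (auto simp: progression_def e_def)
  have "\<forall>j. \<exists>i. j \<le> Suc m \<longrightarrow> e j \<in> P i"
    using e_B B(2) by blast
  from choice[OF this] obtain g where g: "\<And>j. j \<le> Suc m \<Longrightarrow> e j \<in> P (g j)"
    by blast
  have step: "g (Suc j) = g j" if "1 \<le> j" "j \<le> m" for j
  proof -
    have "c \<le> e j"
      using that(1) unfolding e_def by (cases j) auto
    moreover have "e (Suc j) = e j + c"
      by (simp add: e_def)
    ultimately have "e j < e (Suc j)" "e (Suc j) \<le> 2 * e j"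
      using ac(2) by linarith+
    then show ?thesis
      using sep[of "g j" "g (Suc j)" "e j" "e (Suc j)"] sep[of "g (Suc j)" "g j" "e (Suc j)" "e j"]
        g[of j] g[of "Suc j"] that(2) by (cases "g j" "g (Suc j)" rule: linorder_cases) auto
  qed
  have same: "g (Suc j) = g 1" if "j \<le> m" for j
    using that
  proof (induction j)
    case (Suc j)
    then show ?case
      using step[of "Suc j"] by simp
  qed simp
  have "progression (e 1) c m \<subseteq> B \<inter> P (g 1)"
  proof
    fix d assume "d \<in> progression (e 1) c m"
    then obtain j where "j \<le> m" "d = e (Suc j)"
      by (auto simp: progression_def e_def)
    then show "d \<in> B \<inter> P (g 1)"
      using e_B[of "Suc j"] g[of "Suc j"] same[of j] by simp
  qed
  moreover have "K \<le> g 1"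
  proof (rule ccontr)
    assume "\<not> K \<le> g 1"
    then have "e 1 \<in> (\<Union>i<K. P i)"
      using g[of 1] by (intro UN_I[of "g 1"]) simp_all
    then have "e 1 < N"
      by (rule N)
    then show False
      using ac(1) by (simp add: e_def)
  qed
  ultimately show ?thesis
    using ac(2) by blast
qed

section \<open>Additive maps on complete groups\<close>

text \<open>
  The analogue of the hypercyclicity criterion in which a single approximate preimage of
  \<open>y\<close> serves all times of a progression.
\<close>

definition AP_hypercyclicity_criterion ::
    "('a::{ab_group_add,topological_space} \<Rightarrow> 'a) \<Rightarrow> bool" where
  "AP_hypercyclicity_criterion T \<longleftrightarrow>
     (\<exists>(n :: nat \<Rightarrow> nat \<Rightarrow> nat) (a :: nat \<Rightarrow> nat) (c :: nat \<Rightarrow> nat)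
         (X\<^sub>0 :: 'a set) (Y\<^sub>0 :: 'a set) (S :: nat \<Rightarrow> nat \<Rightarrow> 'a \<Rightarrow> 'a).
       (\<forall>k. c k \<ge> 1 \<and> (\<forall>j\<le>k. n k j = a k + j * c k)) \<and>
       closure X\<^sub>0 = UNIV \<and> closure Y\<^sub>0 = UNIV \<and>
       (\<forall>x\<in>X\<^sub>0. \<forall>y\<in>Y\<^sub>0.
          (\<forall>J. (\<forall>k. J k \<le> k) \<longrightarrow> (\<lambda>k. (T ^^ n k (J k)) x) \<longlonglongrightarrow> 0) \<and>
          (\<lambda>k. \<Sum>j\<le>k. S k j y) \<longlonglongrightarrow> 0 \<and>
          (\<forall>J. (\<forall>k. J k \<le> k) \<longrightarrow> (\<lambda>k. (T ^^ n k (J k)) (\<Sum>j\<le>k. S k j y)) \<longlonglongrightarrow> y)))"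

text \<open>
  Convergence along every choice of indices is uniform in the index: otherwise choosing a bad
  index whenever there is one would give a choice along which convergence fails.
\<close>

lemma eventually_for_all_choices:
  fixes f :: "nat \<Rightarrow> nat \<Rightarrow> 'b::topological_space"
  assumes lim: "\<And>J. (\<forall>k. J k \<le> k) \<Longrightarrow> (\<lambda>k. f k (J k)) \<longlonglongrightarrow> l"
    and U: "open U" "l \<in> U"
  shows "\<forall>\<^sub>F k in sequentially. \<forall>j\<le>k. f k j \<in> U"
proof -
  define bad where "bad k j \<longleftrightarrow> j \<le> k \<and> f k j \<notin> U" for k j
  define J where "J k = (if \<exists>j. bad k j then SOME j. bad k j else 0)" for k
  have J: "bad k (J k)" if "bad k j" for k j
    using that someI_ex[of "bad k"] by (auto simp: J_def)
  have "J k \<le> k" for k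
  proof (cases "\<exists>j. bad k j")
    case True
    then have "bad k (J k)"
      using J by blast
    then show ?thesis
      by (simp add: bad_def)
  next
    case False
    then show ?thesis
      unfolding J_def by (subst if_not_P) simp_all
  qed
  then have "\<forall>\<^sub>F k in sequentially. f k (J k) \<in> U"
    using topological_tendstoD[OF lim U] by blast
  then show ?thesis
    by (rule eventually_mono) (use J in \<open>auto simp: bad_def\<close>)
qed

lemma dense_meets_open:
  fixes D :: "'b::topological_space set"
  assumes "closure D = UNIV" "open U" "U \<noteq> {}"
  obtains x where "x \<in> D" "x \<in> U"
  using assms open_Int_closure_eq_empty[of U D] by blast

locale F_normed_operator = complete_F_norm q
  for q :: "'a::{ab_group_add,topological_space} \<Rightarrow> real" +
  fixes T :: "'a \<Rightarrow> 'a"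
  assumes T_add: "T (x + y) = T x + T y"
    and T_cont: "continuous_on UNIV T"
    and separable: "separable_space (euclidean :: 'a topology)"
    and q_small: "x \<noteq> 0 \<Longrightarrow> e > 0 \<Longrightarrow> \<exists>y. y \<noteq> 0 \<and> q y < e"
begin

lemma funpow_T_add: "(T ^^ n) (x + y) = (T ^^ n) x + (T ^^ n) y"
  by (induction n) (simp_all add: T_add)

lemma funpow_T_zero: "(T ^^ n) 0 = 0"
  using funpow_T_add[of n 0 0] by simp

lemma funpow_T_tendsto:
  assumes "(f \<longlongrightarrow> l) F"
  shows "((\<lambda>x. (T ^^ n) (f x)) \<longlongrightarrow> (T ^^ n) l) F"
  by (rule continuous_on_tendsto_compose[OF continuous_on_funpow[OF T_cont] assms]) auto

lemma open_minus_point: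
  assumes "open U"
  shows "open (U - {x :: 'a})"
proof -
  have "open (- {x})"
    unfolding open_iff_q
  proof
    fix y assume "y \<in> - {x}"
    then have "q (x - y) \<noteq> 0"
      by (auto simp: q_zero_iff)
    then have "q (x - y) > 0"
      using q_nonneg[of "x - y"] by linarith
    moreover have "\<forall>z. q (z - y) < q (x - y) \<longrightarrow> z \<in> - {x}"
      by auto
    ultimately show "\<exists>e>0. \<forall>z. q (z - y) < e \<longrightarrow> z \<in> - {x}"
      by blast
  qed
  then show ?thesis
    using open_Int[OF assms] by (simp add: Diff_eq)
qed

text \<open>
  A group with arbitrarily small nonzero elements has no isolated points, so no finite set
  exhausts a nonempty open set.
\<close>

lemma open_avoiding_finite:
  assumes "x \<noteq> (0 :: 'a)" "finite F" "open U" "U \<noteq> ({} :: 'a set)"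
  shows "\<exists>U'\<subseteq>U. open U' \<and> U' \<noteq> {} \<and> U' \<inter> F = {}"
  using assms(2)
proof (induction F rule: finite_induct)
  case empty
  then show ?case
    using assms by blast
next
  case (insert f F)
  then obtain U' where U': "U' \<subseteq> U" "open U'" "U' \<noteq> {}" "U' \<inter> F = {}"
    by blast
  have "U' - {f} \<noteq> {}"
  proof (cases "f \<in> U'")
    case True
    then obtain e where e: "e > 0" "{y. q (y - f) < e} \<subseteq> U'"
      using open_contains_q_ball U'(2) by blast
    obtain y where y: "y \<noteq> 0" "q y < e"
      using q_small[OF assms(1) e(1)] by blast
    then have "f + y \<in> U' - {f}"
      using e(2) by auto
    then show ?thesis
      by blast
  qed (use U'(3) in auto)
  then show ?case
    using U' open_minus_point[OF U'(2), of f] by (intro exI[of _ "U' - {f}"]) auto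
qed

text \<open>
  A point with dense orbit enters \<open>U \<times> U'\<close> at some time \<open>n\<close>, but it may visit \<open>V \<times> V'\<close>
  before that.  Removing the finitely many earlier points of the orbit from \<open>V\<close> forces a later
  visit; this requires that there be no isolated points, so the trivial space is treated apart.
\<close>

lemma weakly_mixing_imp_pair_transitive:
  assumes "weakly_mixing euclidean T"
  shows "pair_transitive T"
  unfolding pair_transitive_def
proof (intro allI impI, elim conjE)
  fix U V U' V' :: "'a set"
  assume o: "open U" "open V" "open U'" "open V'"
    and ne: "U \<noteq> {}" "V \<noteq> {}" "U' \<noteq> {}" "V' \<noteq> {}"
  show "\<exists>n. sends T {n} U V \<and> sends T {n} U' V'"
  proof (cases "\<exists>x :: 'a. x \<noteq> 0")
    case False
    have all: "W = UNIV" if "W \<noteq> {}" for W :: "'a set"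
    proof -
      from that obtain w where "w \<in> W" by blast
      then have "x \<in> W" for x
        using False by metis
      then show ?thesis by blast
    qed
    show ?thesis
      unfolding all[OF ne(1)] all[OF ne(2)] all[OF ne(3)] all[OF ne(4)] sends_def by blast
  next
    case True
    then obtain p :: 'a where p: "p \<noteq> 0"
      by blast
    obtain z where z: "prod_topology euclidean euclidean closure_of range (\<lambda>n. (map_prod T T ^^ n) z) =
        topspace (prod_topology euclidean euclidean)"
      using assms unfolding weakly_mixing_def hypercyclic_def by blast
    obtain x y where xy: "z = (x, y)"
      by (cases z)
    have visit: "\<exists>n. (T ^^ n) x \<in> W \<and> (T ^^ n) y \<in> W'"
      if W: "open W" "W \<noteq> {}" "open W'" "W' \<noteq> {}" for W W'
    proof -
      have "openin (prod_topology euclidean euclidean) (W \<times> W')" "W \<times> W' \<noteq> {}"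
        using W by (auto simp: open_Times)
      then have "range (\<lambda>n. (map_prod T T ^^ n) z) \<inter> (W \<times> W') \<noteq> {}"
        using z unfolding dense_intersects_open by blast
      then show ?thesis
        unfolding xy map_prod_funpow by blast
    qed
    obtain n where n: "(T ^^ n) x \<in> U" "(T ^^ n) y \<in> U'"
      using visit o(1,3) ne(1,3) by blast
    obtain W where W: "W \<subseteq> V" "open W" "W \<noteq> {}" "W \<inter> (\<lambda>i. (T ^^ i) x) ` {..<n} = {}"
      using open_avoiding_finite[OF p _ o(2) ne(2), of "(\<lambda>i. (T ^^ i) x) ` {..<n}"] by auto
    obtain m where m: "(T ^^ m) x \<in> W" "(T ^^ m) y \<in> V'"
      using visit W(2,3) o(4) ne(4) by blast
    have "n \<le> m"
      using W(4) m(1) by (meson disjoint_iff imageI lessThan_iff not_le)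
    then have split: "(T ^^ m) v = (T ^^ (m - n)) ((T ^^ n) v)" for v
      by (metis comp_apply funpow_add le_add_diff_inverse2)
    have "sends T {m - n} U V" "sends T {m - n} U' V'"
      unfolding sends_singleton using n m W(1) split[of x] split[of y] by auto
    then show ?thesis
      by blast
  qed
qed

text \<open>
  The set \<open>G l\<close> collects the points that some progression of \<open>l + 1\<close> times moves close to
  \<open>0\<close>, while it moves a vector \<open>u\<close> close to \<open>0\<close> near the point itself.  It is open, and
  it is dense by simultaneous progressions for two pairs: from near \<open>p\<close> to near \<open>0\<close>, and
  from near \<open>0\<close> to near \<open>p\<close>.  A generic \<open>z\<close> lies in every \<open>G l\<close> and has dense orbit.
\<close>

lemma AP_criterion_if_recurrent:
  assumes trans: "pair_transitive T" and rec: "multiply_recurrent euclidean T"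
  shows "AP_hypercyclicity_criterion T"
proof -
  define r where "r l = inverse (real (Suc l))" for l
  have r_pos: "r l > 0" for l
    by (simp add: r_def)
  define G where "G l = (\<Union>(u, a, c)\<in>{(u, a, c). q u < r l \<and> c \<ge> 1}.
      \<Inter>d\<in>progression a c l. {x. q ((T ^^ d) x) < r l \<and> q ((T ^^ d) u - x) < r l})" for l
  have G_open: "open (G l)" for l
  proof -
    have "open {x. q ((T ^^ d) x) < r l \<and> q ((T ^^ d) u - x) < r l}" for d u
    proof -
      have "{x. q ((T ^^ d) x) < r l \<and> q ((T ^^ d) u - x) < r l} =
          (T ^^ d) -` {y. q (y - 0) < r l} \<inter> {x. q (x - (T ^^ d) u) < r l}"
        by (auto simp: q_commute)
      then show ?thesis
        by (simp only:) (intro open_Int open_funpow_vimage T_cont open_q_ball)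
    qed
    then show ?thesis
      unfolding G_def by (auto intro!: open_UN open_INT finite_progression)
  qed
  have G_dense: "G l \<inter> W \<noteq> {}" if W: "open W" "W \<noteq> {}" for l W
  proof -
    obtain p where "p \<in> W"
      using W(2) by blast
    let ?B0 = "{y. q (y - 0) < r l}" and ?Bp = "{y. q (y - p) < r l / 2}"
    have "0 \<in> ?B0"
      using r_pos[of l] by simp
    then have B0: "open ?B0" "?B0 \<noteq> {}"
      using open_q_ball by blast+
    have "p \<in> ?Bp"
      using r_pos[of l] by simp
    then have Bp: "open ?Bp" "?Bp \<noteq> {}" "open (W \<inter> ?Bp)" "W \<inter> ?Bp \<noteq> {}"
      using open_q_ball W(1) \<open>p \<in> W\<close> by blast+
    let ?U = "\<lambda>i. if i then W \<inter> ?Bp else ?B0" and ?V = "\<lambda>i. if i then ?B0 else ?Bp"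
    have "open (?U i) \<and> ?U i \<noteq> {} \<and> open (?V i) \<and> ?V i \<noteq> {}" for i
      using B0 Bp by (cases i) (simp_all only: if_True if_False simp_thms)
    then obtain a c where c: "c \<ge> 1"
      and *: "\<forall>i\<in>UNIV. sends T (progression a c l) (?U i) (?V i)"
      using simultaneous_progression[OF trans rec T_cont finite[of "UNIV :: bool set"], of ?U ?V l]
      by blast
    obtain x where x: "x \<in> W \<inter> ?Bp" "\<forall>d\<in>progression a c l. (T ^^ d) x \<in> ?B0"
      using bspec[OF *, of True] by (auto simp: sends_def)
    obtain u where u: "u \<in> ?B0" "\<forall>d\<in>progression a c l. (T ^^ d) u \<in> ?Bp"
      using bspec[OF *, of False] by (auto simp: sends_def)
    have "q ((T ^^ d) u - x) < r l" if "d \<in> progression a c l" for d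
    proof -
      have "q ((T ^^ d) u - p) < r l / 2" "q (p - x) < r l / 2"
        using u(2) that x(1) by (auto simp: q_commute)
      then show ?thesis
        using q_triangle[of "(T ^^ d) u" x p] by simp
    qed
    then have "x \<in> G l"
      unfolding G_def using c x(2) u(1) by (intro UN_I[of "(u, a, c)"]) auto
    then show ?thesis
      using x(1) by blast
  qed
  obtain \<B> where \<B>: "countable \<B>" "\<forall>B\<in>\<B>. open B \<and> B \<noteq> {}"
    "\<forall>U :: 'a set. open U \<and> U \<noteq> {} \<longrightarrow> (\<exists>B\<in>\<B>. B \<subseteq> U)"
    using countable_pi_base[OF separable] by blast
  obtain z where z: "z \<in> \<Inter>(range G)"
    "\<And>V m. openin euclidean V \<Longrightarrow> V \<noteq> {} \<Longrightarrow> \<exists>D\<in>range (\<lambda>n. {n}). \<forall>d\<in>D. (T ^^ d) z \<in> V"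
  proof (rule generic_point[of euclidean T \<B> "range G" "\<lambda>m::nat. range (\<lambda>n. {n})"])
    show "completely_metrizable_space (euclidean :: 'a topology)"
      by (rule completely_metrizable_euclidean)
    show "openin euclidean B \<and> B \<noteq> {}" if "B \<in> \<B>" for B
      using \<B>(2) that by simp
    show "\<exists>B\<in>\<B>. B \<subseteq> U" if "openin euclidean U" "U \<noteq> {}" for U
      using \<B>(3) that by simp
    show "openin euclidean V \<and> euclidean closure_of V = topspace euclidean" if "V \<in> range G" for V
      unfolding dense_intersects_open using that G_open G_dense by auto
    show "\<exists>D\<in>range (\<lambda>n. {n}). sends T D U V"
      if "openin euclidean U" "U \<noteq> {}" "openin euclidean V" "V \<noteq> {}" for U V
      using pair_transitiveD[OF trans, of U V U V] that by auto
  qed (use T_cont \<B>(1) in auto)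
  have "\<forall>l. \<exists>u a c. q u < r l \<and> c \<ge> 1 \<and>
      (\<forall>j\<le>l. q ((T ^^ (a + j * c)) z) < r l \<and> q ((T ^^ (a + j * c)) u - z) < r l)"
  proof
    fix l
    have "z \<in> G l"
      using z(1) by blast
    then obtain u a c where "q u < r l" "c \<ge> 1"
      "\<forall>d\<in>progression a c l. q ((T ^^ d) z) < r l \<and> q ((T ^^ d) u - z) < r l"
      unfolding G_def by auto
    then show "\<exists>u a c. q u < r l \<and> c \<ge> 1 \<and>
        (\<forall>j\<le>l. q ((T ^^ (a + j * c)) z) < r l \<and> q ((T ^^ (a + j * c)) u - z) < r l)"
      unfolding progression_def by blast
  qed
  then obtain u a c where uac: "\<And>l. q (u l) < r l" "\<And>l. c l \<ge> (1 :: nat)"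
    "\<And>l j. j \<le> l \<Longrightarrow> q ((T ^^ (a l + j * c l)) z) < r l"
    "\<And>l j. j \<le> l \<Longrightarrow> q ((T ^^ (a l + j * c l)) (u l) - z) < r l"
    by metis
  have r_lim: "r \<longlonglongrightarrow> 0"
    unfolding r_def by (rule LIMSEQ_inverse_real_of_nat)
  have lim: "f \<longlonglongrightarrow> x" if f: "\<And>k. q (f k - x) < r k" for f and x :: 'a
    unfolding tendsto_iff_q
  proof (intro allI impI)
    fix e :: real assume "e > 0"
    show "\<forall>\<^sub>F k in sequentially. q (f k - x) < e"
      using order_tendstoD(2)[OF r_lim \<open>e > 0\<close>] by eventually_elim (rule less_trans[OF f])
  qed
  define D where "D = range (\<lambda>i. (T ^^ i) z)"
  have D: "closure D = UNIV"
  proof (rule ccontr)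
    assume "closure D \<noteq> UNIV"
    then obtain i where "(T ^^ i) z \<in> - closure D"
      using z(2)[of "- closure D"] by auto
    then show False
      using closure_subset[of D] by (auto simp: D_def)
  qed
  \<comment> \<open>The criterion only involves the sums of the \<open>S k j y\<close> over \<open>j\<close>, so all the weight is
      put on \<open>j = 0\<close>.  A point \<open>y\<close> of the orbit of \<open>z\<close> is approximated by the images of
      \<open>u k\<close> under the power of \<open>T\<close> that takes \<open>z\<close> to \<open>y\<close>.\<close>
  define i where "i y = (SOME i. (T ^^ i) z = y)" for y
  have i: "(T ^^ i y) z = y" if "y \<in> D" for y
    using that someI_ex[of "\<lambda>i. (T ^^ i) z = y"] by (auto simp: D_def i_def)
  define S where "S k j y = (if j = 0 then (T ^^ i y) (u k) else 0)" for k j :: nat and y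
  have S: "(\<Sum>j\<le>k. S k j y) = (T ^^ i y) (u k)" for k y
    by (simp add: S_def)
  have lim_x: "(\<lambda>k. (T ^^ (a k + J k * c k)) x) \<longlonglongrightarrow> 0" if "x \<in> D" "\<forall>k. J k \<le> k" for x J
  proof -
    have "(\<lambda>k. (T ^^ (a k + J k * c k)) z) \<longlonglongrightarrow> 0"
      by (rule lim) (use uac(3) that(2) in simp)
    from funpow_T_tendsto[OF this, of "i x"] show ?thesis
      by (simp add: funpow_commute_apply[of "i x" T] i[OF that(1)] funpow_T_zero)
  qed
  have lim_S: "(\<lambda>k. \<Sum>j\<le>k. S k j y) \<longlonglongrightarrow> 0" for y
  proof -
    have "u \<longlonglongrightarrow> 0"
      by (rule lim) (use uac(1) in simp)
    from funpow_T_tendsto[OF this, of "i y"] show ?thesis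
      by (simp add: S funpow_T_zero)
  qed
  have lim_y: "(\<lambda>k. (T ^^ (a k + J k * c k)) (\<Sum>j\<le>k. S k j y)) \<longlonglongrightarrow> y"
    if "y \<in> D" "\<forall>k. J k \<le> k" for y J
  proof -
    have "(\<lambda>k. (T ^^ (a k + J k * c k)) (u k)) \<longlonglongrightarrow> z"
      by (rule lim) (use uac(4) that(2) in simp)
    from funpow_T_tendsto[OF this, of "i y"] show ?thesis
      by (simp add: S funpow_commute_apply[of "i y" T] i[OF that(1)])
  qed
  show ?thesis
    unfolding AP_hypercyclicity_criterion_def
    by (rule exI[of _ "\<lambda>k j. a k + j * c k"], rule exI[of _ a], rule exI[of _ c],
        rule exI[of _ D], rule exI[of _ D], rule exI[of _ S])
       (use uac(2) D lim_x lim_S lim_y in simp)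
qed

text \<open>
  The sequence along which \<open>T\<close> is shown to be hereditarily AP-hypercyclic enumerates a union of sparse blocks of the criterion.
\<close>

lemma hereditarily_AP_hypercyclic_if_AP_criterion:
  assumes "AP_hypercyclicity_criterion T"
  shows "hereditarily_AP_hypercyclic euclidean T"
proof (cases "\<exists>p :: 'a. p \<noteq> 0")
  case False
  have "return_set T 0 U = UNIV" if "U \<noteq> {}" for U
  proof -
    from that obtain u where "u \<in> U" by blast
    then have "x \<in> U" for x
      using False by metis
    then show ?thesis
      by (simp add: return_set_def)
  qed
  then have "\<exists>z\<in>topspace euclidean. \<forall>U. openin euclidean U \<and> U \<noteq> {} \<longrightarrow>
      return_set T z U \<inter> range (id \<circ> s) \<in> AP" if "range (id \<circ> s) \<in> AP" for s :: "nat \<Rightarrow> nat"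
    using that by (intro bexI[of _ 0]) simp_all
  moreover have "range id \<in> AP"
    unfolding AP_def by auto
  ultimately show ?thesis
    unfolding hereditarily_AP_hypercyclic_def using strict_mono_id by blast
next
  case True
  then obtain p :: 'a where p: "p \<noteq> 0"
    by blast
  obtain n a c X Y S where c: "\<forall>k. c k \<ge> (1::nat) \<and> (\<forall>j\<le>k. n k j = a k + j * c k)"
    and dense: "closure X = UNIV" "closure Y = (UNIV :: 'a set)"
    and lims: "\<forall>x\<in>X. \<forall>y\<in>Y.
          (\<forall>J. (\<forall>k. J k \<le> k) \<longrightarrow> (\<lambda>k. (T ^^ n k (J k)) x) \<longlonglongrightarrow> 0) \<and>
          (\<lambda>k::nat. \<Sum>j\<le>k. S k j y) \<longlonglongrightarrow> 0 \<and>
          (\<forall>J. (\<forall>k. J k \<le> k) \<longrightarrow> (\<lambda>k. (T ^^ n k (J k)) (\<Sum>j\<le>k. S k j y)) \<longlonglongrightarrow> y)"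
    using assms unfolding AP_hypercyclicity_criterion_def by blast
  define w where "w k y = (\<Sum>j\<le>k. S k j y)" for k y
  have ev: "\<forall>\<^sub>F k in sequentially. \<forall>j\<le>k. q ((T ^^ (a k + j * c k)) x) < e"
    "\<forall>\<^sub>F k in sequentially. \<forall>j\<le>k. q ((T ^^ (a k + j * c k)) (w k y) - y) < e"
    and w_lim: "(\<lambda>k. w k y) \<longlonglongrightarrow> 0"
    if xy: "x \<in> X" "y \<in> Y" and "e > 0" for x y e
  proof -
    have lim: "(\<lambda>k. (T ^^ (a k + J k * c k)) x) \<longlonglongrightarrow> 0"
      "(\<lambda>k. (T ^^ (a k + J k * c k)) (w k y)) \<longlonglongrightarrow> y" if J: "\<forall>k. J k \<le> k" for J
    proof -
      have n: "n k (J k) = a k + J k * c k" for k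
        using c J by blast
      show "(\<lambda>k. (T ^^ (a k + J k * c k)) x) \<longlonglongrightarrow> 0"
        "(\<lambda>k. (T ^^ (a k + J k * c k)) (w k y)) \<longlonglongrightarrow> y"
        using lims xy J unfolding n[symmetric] w_def by blast+
    qed
    have "\<forall>\<^sub>F k in sequentially. \<forall>j\<le>k. (T ^^ (a k + j * c k)) x \<in> {v. q (v - 0) < e}"
      by (rule eventually_for_all_choices[OF lim(1) open_q_ball]) (simp_all add: \<open>e > 0\<close>)
    then show "\<forall>\<^sub>F k in sequentially. \<forall>j\<le>k. q ((T ^^ (a k + j * c k)) x) < e"
      by simp
    have "\<forall>\<^sub>F k in sequentially. \<forall>j\<le>k. (T ^^ (a k + j * c k)) (w k y) \<in> {v. q (v - y) < e}"
      by (rule eventually_for_all_choices[OF lim(2) open_q_ball]) (simp_all add: \<open>e > 0\<close>)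
    then show "\<forall>\<^sub>F k in sequentially. \<forall>j\<le>k. q ((T ^^ (a k + j * c k)) (w k y) - y) < e"
      by simp
    show "(\<lambda>k. w k y) \<longlonglongrightarrow> 0"
      using lims xy unfolding w_def by blast
  qed

  \<comment> \<open>If \<open>a k \<le> M\<close>, then \<open>T ^^ a k\<close> is one of finitely many continuous additive maps, so it
      sends \<open>w k y\<close>, which tends to \<open>0\<close>, close to \<open>0\<close>.  By the criterion its value is
      also close to \<open>y\<close>, which is impossible for large \<open>k\<close> if \<open>y\<close> is not \<open>0\<close>.\<close>
  have a_unbounded: "\<forall>\<^sub>F k in sequentially. M < a k" for M
  proof -
    obtain x where x: "x \<in> X"
      using dense(1) by force
    obtain y where y: "y \<in> Y" "y \<noteq> 0"
      using dense_meets_open[OF dense(2) open_minus_point[OF open_UNIV, of 0]] p by blast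
    define e where "e = q y / 2"
    have e: "e > 0"
      using y(2) q_zero_iff[of y] q_nonneg[of y] by (simp add: e_def less_le)
    have "\<forall>\<^sub>F k in sequentially. \<forall>v\<in>{..M}. q ((T ^^ v) (w k y)) < e"
    proof (intro eventually_ball_finite ballI)
      fix v
      have "(\<lambda>k. (T ^^ v) (w k y)) \<longlonglongrightarrow> 0"
        using funpow_T_tendsto[OF w_lim[OF x y(1) e], of v] by (simp add: funpow_T_zero)
      then show "\<forall>\<^sub>F k in sequentially. q ((T ^^ v) (w k y)) < e"
        unfolding tendsto_iff_q using e by simp
    qed simp
    then show ?thesis
      using ev(2)[OF x y(1) e]
    proof eventually_elim
      case (elim k)
      show "M < a k"
      proof (rule ccontr)
        assume "\<not> M < a k"
        then have "q ((T ^^ a k) (w k y)) < e"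
          using elim(1) by simp
        moreover have "q (y - (T ^^ a k) (w k y)) < e"
          using elim(2)[rule_format, of 0] by (simp add: q_commute)
        ultimately have "q y < e + e"
          using q_add[of "y - (T ^^ a k) (w k y)" "(T ^^ a k) (w k y)"] by simp
        then show False
          by (simp add: e_def)
      qed
    qed
  qed

  \<comment> \<open>The last element of block \<open>k\<close>; the chosen blocks \<open>f 0, f 1, \<dots>\<close> start
      beyond twice the last element of every earlier one.\<close>
  define b where "b k = a k + k * c k" for k
  have "\<exists>l>k. \<forall>k'\<ge>l. 2 * b k < a k'" for k
  proof -
    obtain K where "\<forall>k'\<ge>K. 2 * b k < a k'"
      using a_unbounded[of "2 * b k"] unfolding eventually_sequentially by blast
    then show ?thesis
      by (intro exI[of _ "max K (Suc k)"]) auto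
  qed
  then have "\<exists>f. \<forall>i. True \<and> f i < f (Suc i) \<and> (\<forall>k'\<ge>f (Suc i). 2 * b (f i) < a k')"
    by (intro dependent_nat_choice) auto
  then obtain f :: "nat \<Rightarrow> nat" where f: "\<forall>i. f i < f (Suc i)"
    "\<forall>i. \<forall>k'\<ge>f (Suc i). 2 * b (f i) < a k'"
    by blast
  have f_mono: "strict_mono f"
    using f(1) by (simp add: strict_mono_Suc_iff)
  define P where "P i = progression (a (f i)) (c (f i)) (f i)" for i
  have sep: "2 * s < t" if "i < i'" "s \<in> P i" "t \<in> P i'" for i i' s t
  proof -
    have "s \<le> b (f i)"
      using that(2) by (auto simp: P_def progression_def b_def)
    moreover have "f (Suc i) \<le> f i'"
      using f_mono that(1) by (simp add: strict_mono_less_eq)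
    then have "2 * b (f i) < a (f i')"
      using f(2) by blast
    moreover have "a (f i') \<le> t"
      using that(3) by (auto simp: P_def progression_def)
    ultimately show ?thesis
      by simp
  qed
  have P_finite: "finite (P i)" for i
    by (simp add: P_def finite_progression)
  define A where "A = (\<Union>i. P i)"
  have A: "A \<in> AP"
    unfolding AP_iff_progression
  proof
    fix m
    have "m \<le> f m"
      using f_mono by (rule strict_mono_imp_increasing)
    then have "progression (a (f m)) (c (f m)) m \<subseteq> P m"
      unfolding P_def progression_def by (intro image_mono) auto
    then show "\<exists>a c. c \<ge> 1 \<and> progression a c m \<subseteq> A"
      using c unfolding A_def by blast
  qed
  have generic: "\<exists>z\<in>topspace euclidean. \<forall>U. openin euclidean U \<and> U \<noteq> {} \<longrightarrow> return_set T z U \<inter> B \<in> AP"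
    if B: "B \<in> AP" "B \<subseteq> A" for B
  proof -
    obtain \<B> where \<B>: "countable \<B>" "\<forall>B\<in>\<B>. open B \<and> B \<noteq> {}"
      "\<forall>U :: 'a set. open U \<and> U \<noteq> {} \<longrightarrow> (\<exists>B\<in>\<B>. B \<subseteq> U)"
      using countable_pi_base[OF separable] by blast
    show ?thesis
    proof (rule AP_generic_point[of _ _ \<B>])
      show "completely_metrizable_space (euclidean :: 'a topology)"
        by (rule completely_metrizable_euclidean)
      show "openin euclidean B \<and> B \<noteq> {}" if "B \<in> \<B>" for B
        using \<B>(2) that by simp
      show "\<exists>B\<in>\<B>. B \<subseteq> U" if "openin euclidean U" "U \<noteq> {}" for U
        using \<B>(3) that by simp
      fix U V :: "'a set" and m
      assume "openin euclidean U" "U \<noteq> {}" "openin euclidean V" "V \<noteq> {}"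
      then have U: "open U" "U \<noteq> {}" and V: "open V" "V \<noteq> {}"
        by simp_all
      obtain x where x: "x \<in> X" "x \<in> U"
        by (rule dense_meets_open[OF dense(1) U])
      obtain y where y: "y \<in> Y" "y \<in> V"
        by (rule dense_meets_open[OF dense(2) V])
      obtain e where e: "e > 0" "{v. q (v - x) < e} \<subseteq> U"
        by (rule open_contains_q_ball[OF U(1) x(2)])
      obtain e' where e': "e' > 0" "{v. q (v - y) < e'} \<subseteq> V"
        by (rule open_contains_q_ball[OF V(1) y(2)])
      have half: "e' / 2 > 0"
        using e'(1) by simp
      have "\<forall>\<^sub>F k in sequentially. q (w k y) < e"
        using w_lim[OF x(1) y(1) e(1)] e(1) unfolding tendsto_iff_q by simp
      then have "\<forall>\<^sub>F k in sequentially. q (w k y) < e \<and>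
          (\<forall>j\<le>k. q ((T ^^ (a k + j * c k)) x) < e' / 2) \<and>
          (\<forall>j\<le>k. q ((T ^^ (a k + j * c k)) (w k y) - y) < e' / 2)"
        by (intro eventually_conj ev[OF x(1) y(1) half])
      then obtain K where K: "\<And>k. k \<ge> K \<Longrightarrow> q (w k y) < e"
        "\<And>k j. k \<ge> K \<Longrightarrow> j \<le> k \<Longrightarrow> q ((T ^^ (a k + j * c k)) x) < e' / 2"
        "\<And>k j. k \<ge> K \<Longrightarrow> j \<le> k \<Longrightarrow> q ((T ^^ (a k + j * c k)) (w k y) - y) < e' / 2"
        unfolding eventually_sequentially by blast
      have "\<exists>i\<ge>K. \<exists>a c. c \<ge> 1 \<and> progression a c m \<subseteq> B \<inter> P i"
      proof (rule AP_in_sparse_blocks)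
        show "2 * s < t" if "i < i'" "s \<in> P i" "t \<in> P i'" for i i' s t
          using that by (rule sep)
      qed (use P_finite B in \<open>simp_all add: A_def\<close>)
      then obtain i a' c' where i: "i \<ge> K" and c': "c' \<ge> 1" "progression a' c' m \<subseteq> B \<inter> P i"
        by blast
      define k where "k = f i"
      have k: "k \<ge> K"
        using i strict_mono_imp_increasing[OF f_mono, of i] by (simp add: k_def)
      have "x + w k y \<in> U"
        using e(2) K(1)[OF k] by (auto intro!: subsetD[OF e(2)])
      moreover have "(T ^^ d) (x + w k y) \<in> V" if "d \<in> progression a' c' m" for d
      proof -
        have "d \<in> P i"
          using c'(2) that by blast
        then obtain j where j: "j \<le> k" "d = a k + j * c k"
          by (auto simp: P_def progression_def k_def)
        have "q ((T ^^ d) (x + w k y) - y) \<le> q ((T ^^ d) x) + q ((T ^^ d) (w k y) - y)"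
          using q_add[of "(T ^^ d) x" "(T ^^ d) (w k y) - y"] by (simp add: funpow_T_add algebra_simps)
        also have "\<dots> < e'"
          using K(2,3)[OF k j(1)] unfolding j(2) by simp
        finally show ?thesis
          using e'(2) by blast
      qed
      ultimately have "sends T (progression a' c' m) U V"
        unfolding sends_def by blast
      then show "\<exists>a c. c \<ge> 1 \<and> progression a c m \<subseteq> B \<and> sends T (progression a c m) U V"
        using c' by blast
    qed (use T_cont \<B>(1) in auto)
  qed
  have "infinite A"
    by (rule AP_imp_infinite[OF A])
  then have "strict_mono (enumerate A)" "range (enumerate A) = A"
    by (simp_all add: strict_mono_enumerate range_enumerate)
  moreover have "range (enumerate A \<circ> s) \<subseteq> A" for s :: "nat \<Rightarrow> nat"
    using calculation(2) by auto
  ultimately show ?thesis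
    unfolding hereditarily_AP_hypercyclic_def using A generic by (intro exI[of _ "enumerate A"]) auto
qed

end

section \<open>The equivalences\<close>

lemma two_targets_condition_iff:
  fixes T :: "'a::topological_space \<Rightarrow> 'a"
  assumes cont: "continuous_on UNIV T"
  shows "pair_transitive T \<and> multiply_recurrent euclidean T \<longleftrightarrow>
       (\<forall>U V\<^sub>1 V\<^sub>2 :: 'a set.
       open U \<and> U \<noteq> {} \<and> open V\<^sub>1 \<and> V\<^sub>1 \<noteq> {} \<and> open V\<^sub>2 \<and> V\<^sub>2 \<noteq> {} \<longrightarrow>
       (\<forall>m::nat. \<exists>x\<^sub>1\<in>U. \<exists>x\<^sub>2\<in>U. \<exists>a k :: nat. k \<ge> 1 \<and>
          (\<forall>j\<le>m. (T ^^ (a + j * k)) x\<^sub>1 \<in> V\<^sub>1 \<and> (T ^^ (a + j * k)) x\<^sub>2 \<in> V\<^sub>2)))"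
  (is "?H \<longleftrightarrow> ?C")
proof
  assume H: ?H
  show ?C
  proof (intro allI impI, elim conjE)
    fix U V1 V2 :: "'a set" and m :: nat
    assume *: "open U" "U \<noteq> {}" "open V1" "V1 \<noteq> {}" "open V2" "V2 \<noteq> {}"
    let ?V = "\<lambda>i. if i then V1 else V2"
    have "open U \<and> U \<noteq> {} \<and> open (?V i) \<and> ?V i \<noteq> {}" for i
      using * by simp
    then obtain a c where c: "c \<ge> 1" and
      sends: "\<forall>i\<in>UNIV. sends T (progression a c m) U (?V i)"
      using simultaneous_progression[OF conjunct1[OF H] conjunct2[OF H] cont
          finite[of "UNIV :: bool set"], of "\<lambda>_. U" ?V m] by blast
    obtain x where "x \<in> U" "\<forall>d\<in>progression a c m. (T ^^ d) x \<in> V1"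
      using bspec[OF sends, of True] by (auto simp: sends_def)
    moreover obtain y where "y \<in> U" "\<forall>d\<in>progression a c m. (T ^^ d) y \<in> V2"
      using bspec[OF sends, of False] by (auto simp: sends_def)
    ultimately show "\<exists>x\<^sub>1\<in>U. \<exists>x\<^sub>2\<in>U. \<exists>a k. 1 \<le> k \<and>
        (\<forall>j\<le>m. (T ^^ (a + j * k)) x\<^sub>1 \<in> V1 \<and> (T ^^ (a + j * k)) x\<^sub>2 \<in> V2)"
      using c unfolding progression_def by blast
  qed
next
  assume C: ?C
  have "pair_transitive T"
  proof (rule pair_transitive_if_common_source[OF cont])
    fix U V V' :: "'a set"
    assume *: "open U" "U \<noteq> {}" "open V" "V \<noteq> {}" "open V'" "V' \<noteq> {}"
    obtain x y a where "x \<in> U" "y \<in> U" "(T ^^ a) x \<in> V" "(T ^^ a) y \<in> V'"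
      using C[rule_format, of U V V' 0] * by auto
    then show "\<exists>n. sends T {n} U V \<and> sends T {n} U V'"
      by (auto simp: sends_def)
  qed
  moreover have "multiply_recurrent euclidean T"
  proof (rule multiply_recurrent_if_progressions)
    fix U :: "'a set" and m :: nat
    assume "open U" "U \<noteq> {}"
    then obtain x a c where "c \<ge> 1" "\<forall>j\<le>m. (T ^^ (a + j * c)) x \<in> U"
      using C[rule_format, of U U U m] by blast
    then show "\<exists>x a c. c \<ge> 1 \<and> (\<forall>d\<in>progression a c m. (T ^^ d) x \<in> U)"
      unfolding progression_def by blast
  qed
  ultimately show ?H
    by blast
qed

theorem theorem4p2:
  fixes smul :: "'k::real_normed_field \<Rightarrow> 'a::{ab_group_add,topological_space} \<Rightarrow> 'a"
    and T :: "'a \<Rightarrow> 'a"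
  assumes "frechet_space smul"
    and "separable_space (euclidean :: 'a topology)"
    and "Vector_Spaces.linear smul smul T"
    and "continuous_on UNIV T"
  shows
    "(weakly_mixing euclidean T \<and> multiply_recurrent euclidean T \<longleftrightarrow>
       AP_hypercyclic (prod_topology euclidean euclidean) (map_prod T T)) \<and>
     (weakly_mixing euclidean T \<and> multiply_recurrent euclidean T \<longleftrightarrow>
       (\<forall>n\<ge>1. AP_hypercyclic (power_space n euclidean) (power_map n T))) \<and>
     (weakly_mixing euclidean T \<and> multiply_recurrent euclidean T \<longleftrightarrow>
       hereditarily_AP_hypercyclic euclidean T) \<and>
     (weakly_mixing euclidean T \<and> multiply_recurrent euclidean T \<longleftrightarrow>
       (\<exists>(n :: nat \<Rightarrow> nat \<Rightarrow> nat) (a :: nat \<Rightarrow> nat) (c :: nat \<Rightarrow> nat)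
         (X\<^sub>0 :: 'a set) (Y\<^sub>0 :: 'a set) (S :: nat \<Rightarrow> nat \<Rightarrow> 'a \<Rightarrow> 'a).
       (\<forall>k. c k \<ge> 1 \<and> (\<forall>j\<le>k. n k j = a k + j * c k)) \<and>
       closure X\<^sub>0 = UNIV \<and> closure Y\<^sub>0 = UNIV \<and>
       (\<forall>x\<in>X\<^sub>0. \<forall>y\<in>Y\<^sub>0.
          (\<forall>J. (\<forall>k. J k \<le> k) \<longrightarrow> (\<lambda>k. (T ^^ n k (J k)) x) \<longlonglongrightarrow> 0) \<and>
          (\<lambda>k. \<Sum>j\<le>k. S k j y) \<longlonglongrightarrow> 0 \<and>
          (\<forall>J. (\<forall>k. J k \<le> k) \<longrightarrow> (\<lambda>k. (T ^^ n k (J k)) (\<Sum>j\<le>k. S k j y)) \<longlonglongrightarrow> y)))) \<and>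
     (weakly_mixing euclidean T \<and> multiply_recurrent euclidean T \<longleftrightarrow>
       (\<forall>U V\<^sub>1 V\<^sub>2 :: 'a set.
       open U \<and> U \<noteq> {} \<and> open V\<^sub>1 \<and> V\<^sub>1 \<noteq> {} \<and> open V\<^sub>2 \<and> V\<^sub>2 \<noteq> {} \<longrightarrow>
       (\<forall>m::nat. \<exists>x\<^sub>1\<in>U. \<exists>x\<^sub>2\<in>U. \<exists>a k :: nat. k \<ge> 1 \<and>
          (\<forall>j\<le>m. (T ^^ (a + j * k)) x\<^sub>1 \<in> V\<^sub>1 \<and> (T ^^ (a + j * k)) x\<^sub>2 \<in> V\<^sub>2))))"
proof -
  interpret L: Vector_Spaces.linear smul smul T
    by (rule assms(3))
  obtain q :: "'a \<Rightarrow> real" where q: "complete_F_norm q"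
    and small: "(\<exists>x :: 'a. x \<noteq> 0) \<longrightarrow> (\<forall>e>0. \<exists>y. y \<noteq> 0 \<and> q y < e)"
    using frechet_space_F_norm[OF assms(1)] by (elim exE conjE) (rule that)
  interpret F_normed_operator q T
    by (rule F_normed_operator.intro[OF q]) (unfold_locales, use small L.add assms(2,4) in auto)
  obtain \<B> :: "'a set set" where \<B>: "countable \<B>" "\<forall>B\<in>\<B>. open B \<and> B \<noteq> {}"
    "\<forall>U :: 'a set. open U \<and> U \<noteq> {} \<longrightarrow> (\<exists>B\<in>\<B>. B \<subseteq> U)"
    using countable_pi_base[OF separable] by blast

  let ?i = "weakly_mixing euclidean T \<and> multiply_recurrent euclidean T"
  let ?H = "pair_transitive T \<and> multiply_recurrent euclidean T"
  let ?ii = "AP_hypercyclic (prod_topology euclidean euclidean) (map_prod T T)"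
  let ?iii = "\<forall>n\<ge>1. AP_hypercyclic (power_space n euclidean) (power_map n T)"
  let ?iv = "hereditarily_AP_hypercyclic euclidean T"
  let ?v = "AP_hypercyclicity_criterion T"
  have "?i \<Longrightarrow> ?H"
    using weakly_mixing_imp_pair_transitive by blast
  moreover have "?H \<Longrightarrow> ?iii"
    using AP_hypercyclic_power[OF completely_metrizable_euclidean \<B>(1)] \<B>(2,3) T_cont by simp
  moreover have "?iii \<Longrightarrow> ?ii"
    using AP_hypercyclic_square_of_power[of T] by simp
  moreover have "?ii \<Longrightarrow> ?i"
    by (rule AP_hypercyclic_square_imp)
  moreover have "?H \<Longrightarrow> ?v"
    using AP_criterion_if_recurrent by blast
  moreover have "?v \<Longrightarrow> ?iv"
    by (rule hereditarily_AP_hypercyclic_if_AP_criterion)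
  moreover have "?iv \<Longrightarrow> ?H"
    using T_cont by (rule hereditarily_AP_hypercyclic_imp[rotated])
  ultimately have "(?i \<longleftrightarrow> ?ii) \<and> (?i \<longleftrightarrow> ?iii) \<and> (?i \<longleftrightarrow> ?iv) \<and> (?i \<longleftrightarrow> ?v) \<and> (?i \<longleftrightarrow> ?H)"
    by argo
  then show ?thesis
    unfolding AP_hypercyclicity_criterion_def two_targets_condition_iff[OF T_cont] .
qed

end
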